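(* Let $p\in(0,\infty)$ with $p\neq2$, let $\mathfrak M$ be a finite factor equipped with its tracial state $\tau$, and let $P,Q\in\mathscr P_{1/2}(\mathfrak M)$. Then $$\|P-Q\|_p=\|(I-P)-Q\|_p=\frac1{\sqrt2}$$ if and only if there exists a partial isometry $U\in\mathfrak M$ such that $U^*U=P$, $UU^*=I-P$ and $Q=(I+U+U^* )/2$.
   Context: A finite factor is a von Neumann algebra factor admitting a (unique, faithful, normal) tracial state, i.e. $M_n(\mathbb C)$ or a $\mathrm{II}_1$ factor. $\mathscr P_{1/2}(\mathfrak M)$ is the set of projections in $\mathfrak M$ with trace $\tau(P)=1/2$, and $\|A\|_p:=\tau(|A|^p)^{1/p}$. *)

theory Defs
  imports "HOL-Analysis.Analysis" "HOL-Computational_Algebra.Polynomial"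
begin

section \<open>Complex Hilbert spaces\<close>

text \<open>The inner product is conjugate-linear in its first argument.\<close>

class chilbert_space = banach +
  fixes scaleC :: "complex \<Rightarrow> 'a \<Rightarrow> 'a" (infixr \<open>*\<^sub>C\<close> 75)
    and cinner :: "'a \<Rightarrow> 'a \<Rightarrow> complex"
  assumes scaleC_add_right: "a *\<^sub>C (x + y) = a *\<^sub>C x + a *\<^sub>C y"
    and scaleC_add_left: "(a + b) *\<^sub>C x = a *\<^sub>C x + b *\<^sub>C x"
    and scaleC_scaleC: "a *\<^sub>C b *\<^sub>C x = (a * b) *\<^sub>C x"
    and scaleC_one: "1 *\<^sub>C x = x"
    and scaleR_scaleC: "r *\<^sub>R x = complex_of_real r *\<^sub>C x"
    and cinner_commute: "cinner x y = cnj (cinner y x)"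
    and cinner_add_right: "cinner x (y + z) = cinner x y + cinner x z"
    and cinner_scaleC_right: "cinner x (a *\<^sub>C y) = a * cinner x y"
    and cinner_self_nonneg: "cinner x x \<in> \<real>\<^sub>\<ge>\<^sub>0"
    and norm_eq_sqrt_cinner: "norm x = sqrt (Re (cinner x x))"

lemma norm_scaleC: "norm (a *\<^sub>C x) = cmod a * norm (x :: 'h::chilbert_space)"
proof -
  have "cinner (a *\<^sub>C x) (a *\<^sub>C x) = a * cnj a * cinner x x"
    by (metis cinner_commute cinner_scaleC_right complex_cnj_mult mult.assoc)
  then have "Re (cinner (a *\<^sub>C x) (a *\<^sub>C x)) = (cmod a)\<^sup>2 * Re (cinner x x)"
    by (simp add: complex_mult_cnj cmod_power2)
  then show ?thesis
    by (simp add: norm_eq_sqrt_cinner real_sqrt_mult)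
qed

lemma bounded_linear_scaleC: "bounded_linear (\<lambda>x :: 'h::chilbert_space. a *\<^sub>C x)"
proof (rule bounded_linear_intro)
  show "a *\<^sub>C (x + y) = a *\<^sub>C x + a *\<^sub>C y" for x y :: 'h
    by (rule scaleC_add_right)
  show "a *\<^sub>C (r *\<^sub>R x) = r *\<^sub>R (a *\<^sub>C x)" for r and x :: 'h
    by (simp add: scaleR_scaleC scaleC_scaleC mult.commute)
  show "norm (a *\<^sub>C x) \<le> norm x * cmod a" for x :: 'h
    by (simp add: norm_scaleC)
qed

section \<open>Bounded operators\<close>

text \<open>
  Operators are elements of the library type of bounded real-linear maps; the
  complex-linear ones form the algebra B(H).
\<close>

type_synonym 'h op = "'h \<Rightarrow>\<^sub>L 'h"

definition bounded_ops :: "('h::chilbert_space) op set" where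
  "bounded_ops = {A. \<forall>c x. blinfun_apply A (c *\<^sub>C x) = c *\<^sub>C blinfun_apply A x}"

lift_definition cscale_op :: "complex \<Rightarrow> ('h::chilbert_space) op \<Rightarrow> 'h op"
  is "\<lambda>c A x. c *\<^sub>C A x"
  by (rule bounded_linear_compose[OF bounded_linear_scaleC])

definition adj :: "('h::chilbert_space) op \<Rightarrow> 'h op" where
  "adj A = (THE B. \<forall>x y. cinner (blinfun_apply B x) y = cinner x (blinfun_apply A y))"

definition positive_op :: "('h::chilbert_space) op \<Rightarrow> bool" where
  "positive_op A \<longleftrightarrow> A \<in> bounded_ops \<and> (\<forall>x. cinner x (blinfun_apply A x) \<in> \<real>\<^sub>\<ge>\<^sub>0)"

definition op_le :: "('h::chilbert_space) op \<Rightarrow> 'h op \<Rightarrow> bool" where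
  "op_le A B \<longleftrightarrow> positive_op (B - A)"

definition projection :: "('h::chilbert_space) op \<Rightarrow> bool" where
  "projection P \<longleftrightarrow> P \<in> bounded_ops \<and> P o\<^sub>L P = P \<and> adj P = P"

definition partial_isometry :: "('h::chilbert_space) op \<Rightarrow> bool" where
  "partial_isometry U \<longleftrightarrow> U \<in> bounded_ops \<and>
     (\<forall>x. (\<forall>y. blinfun_apply U y = 0 \<longrightarrow> cinner y x = 0) \<longrightarrow> norm (blinfun_apply U x) = norm x)"

section \<open>Continuous functional calculus\<close>

definition spectrum :: "('h::chilbert_space) op \<Rightarrow> complex set" where
  "spectrum A = {z. \<not> (\<exists>B\<in>bounded_ops.
      (A - cscale_op z id_blinfun) o\<^sub>L B = id_blinfun \<and>
      B o\<^sub>L (A - cscale_op z id_blinfun) = id_blinfun)}"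

definition poly_op :: "real poly \<Rightarrow> ('h::chilbert_space) op \<Rightarrow> 'h op" where
  "poly_op q A = (\<Sum>i\<le>degree q. coeff q i *\<^sub>R (((o\<^sub>L) A ^^ i) id_blinfun))"

text \<open>
  For self-adjoint \<open>A\<close> (whose spectrum is real) and \<open>f\<close> continuous on the spectrum,
  \<open>cfc f A\<close> is the norm limit of \<open>q n (A)\<close> for any real polynomials \<open>q n\<close> that converge
  to \<open>f\<close> uniformly on the spectrum.
\<close>

definition cfc :: "(real \<Rightarrow> real) \<Rightarrow> ('h::chilbert_space) op \<Rightarrow> 'h op" where
  "cfc f A = (THE B. \<forall>q :: nat \<Rightarrow> real poly.
      uniform_limit {t. complex_of_real t \<in> spectrum A} (\<lambda>n. poly (q n)) f sequentially \<longrightarrow>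
      (\<lambda>n. poly_op (q n) A) \<longlonglongrightarrow> B)"

definition abs_op :: "('h::chilbert_space) op \<Rightarrow> 'h op" where
  "abs_op A = (THE B. positive_op B \<and> B o\<^sub>L B = adj A o\<^sub>L A)"

section \<open>Finite factors\<close>

definition commutant :: "('h::chilbert_space) op set \<Rightarrow> 'h op set" where
  "commutant S = {B \<in> bounded_ops. \<forall>A\<in>S. A o\<^sub>L B = B o\<^sub>L A}"

definition von_neumann_algebra :: "('h::chilbert_space) op set \<Rightarrow> bool" where
  "von_neumann_algebra M \<longleftrightarrow>
     M \<subseteq> bounded_ops \<and> (\<forall>A\<in>M. adj A \<in> M) \<and> commutant (commutant M) = M"

definition factor :: "('h::chilbert_space) op set \<Rightarrow> bool" where
  "factor M \<longleftrightarrow> von_neumann_algebra M \<and>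
     M \<inter> commutant M = range (\<lambda>c. cscale_op c id_blinfun)"

text \<open>Functionals on \<open>M\<close> are total functions; only their values on \<open>M\<close> matter.\<close>

definition tracial_state :: "('h::chilbert_space) op set \<Rightarrow> ('h op \<Rightarrow> complex) \<Rightarrow> bool" where
  "tracial_state M \<tau> \<longleftrightarrow>
     (\<forall>A\<in>M. \<forall>B\<in>M. \<tau> (A + B) = \<tau> A + \<tau> B) \<and>
     (\<forall>c. \<forall>A\<in>M. \<tau> (cscale_op c A) = c * \<tau> A) \<and>
     (\<forall>A\<in>M. positive_op A \<longrightarrow> \<tau> A \<in> \<real>\<^sub>\<ge>\<^sub>0) \<and>
     \<tau> id_blinfun = 1 \<and>
     (\<forall>A\<in>M. \<forall>B\<in>M. \<tau> (A o\<^sub>L B) = \<tau> (B o\<^sub>L A))"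

definition faithful_on :: "('h::chilbert_space) op set \<Rightarrow> ('h op \<Rightarrow> complex) \<Rightarrow> bool" where
  "faithful_on M \<tau> \<longleftrightarrow> (\<forall>A\<in>M. positive_op A \<longrightarrow> \<tau> A = 0 \<longrightarrow> A = 0)"

text \<open>
  Normality of a positive functional: it preserves least upper bounds of upward directed
  sets of positive elements.
\<close>

definition normal_on :: "('h::chilbert_space) op set \<Rightarrow> ('h op \<Rightarrow> complex) \<Rightarrow> bool" where
  "normal_on M \<tau> \<longleftrightarrow>
     (\<forall>D A. D \<noteq> {} \<and> D \<subseteq> {X\<in>M. positive_op X} \<and>
        (\<forall>X\<in>D. \<forall>Y\<in>D. \<exists>Z\<in>D. op_le X Z \<and> op_le Y Z) \<and>
        A \<in> M \<and> (\<forall>X\<in>D. op_le X A) \<and>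
        (\<forall>B\<in>M. (\<forall>X\<in>D. op_le X B) \<longrightarrow> op_le A B)
        \<longrightarrow> Re (\<tau> A) = (SUP X\<in>D. Re (\<tau> X)))"

definition faithful_normal_tracial_state ::
    "('h::chilbert_space) op set \<Rightarrow> ('h op \<Rightarrow> complex) \<Rightarrow> bool" where
  "faithful_normal_tracial_state M \<tau> \<longleftrightarrow>
     tracial_state M \<tau> \<and> faithful_on M \<tau> \<and> normal_on M \<tau>"

definition finite_factor :: "('h::chilbert_space) op set \<Rightarrow> bool" where
  "finite_factor M \<longleftrightarrow> factor M \<and> (\<exists>\<tau>. faithful_normal_tracial_state M \<tau>)"

definition half_projections ::
    "('h::chilbert_space) op set \<Rightarrow> ('h op \<Rightarrow> complex) \<Rightarrow> 'h op set" where
  "half_projections M \<tau> = {P\<in>M. projection P \<and> \<tau> P = 1/2}"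

definition trace_pnorm ::
    "(('h::chilbert_space) op \<Rightarrow> complex) \<Rightarrow> real \<Rightarrow> 'h op \<Rightarrow> real" where
  "trace_pnorm \<tau> p A = Re (\<tau> (cfc (\<lambda>t. t powr p) (abs_op A))) powr (1/p)"

end

theory Submission
  imports Defs "HOL-Computational_Algebra.Fundamental_Theorem_Algebra"
begin

text \<open>
  Put \<open>X = P - Q\<close>, \<open>Y = I - P - Q\<close> and \<open>T = X\<^sup>2\<close>; then \<open>Y\<^sup>2 = I - T\<close>, so the two norms are governed
  by the traces of \<open>T\<close> and \<open>I - T\<close> raised to the power \<open>q = p/2 \<noteq> 1\<close>. The function
  \<open>s \<mapsto> s\<^sup>q + (1 - s)\<^sup>q\<close> on the unit interval has a strict extremum at \<open>s = 1/2\<close>, so faithfulness of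
  the trace forces \<open>T = I/2\<close> as soon as both norms are \<open>1/\<surd>2\<close>. Finally \<open>(P - Q)\<^sup>2 = I/2\<close> is equivalent
  to \<open>U = 2QP - P\<close> being a partial isometry from \<open>P\<close> onto \<open>I - P\<close>, and then \<open>Q = (I + U + U\<^sup>*)/2\<close>.

  The functional calculus rests on \<open>\<parallel>f(A)\<parallel> \<le> sup \<bar>f\<bar>\<close> over the real spectrum, for real polynomials \<open>f\<close>
  and self-adjoint \<open>A\<close>, combined with Weierstrass approximation.
\<close>

section \<open>Complex Hilbert spaces\<close>

text \<open>The scalar extremum is made quantitative: for every \<open>d > 0\<close> there is
  \<open>C\<close> with \<open>(s - 1/2)\<^sup>2 \<le> d + C * defect q s\<close> on the unit
  interval. With polynomials in place of the powers, this becomes positivity of a polynomial in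
  \<open>T\<close>. The trace of the approximated defect tends to 0, so only
  \<open>\<tau> ((T - I/2)\<^sup>2) \<le> d\<close> remains. The exponent \<open>p = 2\<close> is
  degenerate: for \<open>q = 1\<close> the defect vanishes identically.

  Because \<open>I - T\<close> is a polynomial in \<open>T\<close>, one sequence of polynomials
  approximating \<open>s powr q\<close> on \<open>{0..1}\<close> serves both norms. The obstacle is
  that \<open>adj\<close>, \<open>abs_op\<close> and \<open>cfc\<close> are definite descriptions:
  existence and uniqueness come before any value. The absolute value is then eliminated by
  \<open>\<bar>A\<bar>\<^sup>p = (A\<^sup>2)\<^sup>q\<close>.

  The operator \<open>U\<close> is twice the corner \<open>(I - P) Q P\<close> of \<open>Q\<close>,
  which equals \<open>2QP - P\<close> once \<open>PQP = P/2\<close>. Relative to \<open>P\<close>,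
  the diagonal blocks of \<open>Q\<close> are then 1/2 and the off-diagonal ones are
  \<open>U/2\<close> and its adjoint.\<close>

lemma cinner_add_left: "cinner (x + y) z = cinner x z + cinner y z" for x y z :: "'h::chilbert_space"
  by (metis cinner_add_right cinner_commute complex_cnj_add)

lemma cinner_scaleC_left: "cinner (a *\<^sub>C x) y = cnj a * cinner x y" for x y :: "'h::chilbert_space"
  by (metis cinner_commute cinner_scaleC_right complex_cnj_mult)

lemma cinner_scaleR_right: "cinner x (r *\<^sub>R y) = of_real r * cinner x y" for x y :: "'h::chilbert_space"
  by (simp add: scaleR_scaleC cinner_scaleC_right)

lemma cinner_scaleR_left: "cinner (r *\<^sub>R x) y = of_real r * cinner x y" for x y :: "'h::chilbert_space"
  by (simp add: scaleR_scaleC cinner_scaleC_left)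

lemma cinner_zero_right [simp]: "cinner x 0 = 0" for x :: "'h::chilbert_space"
  using cinner_scaleR_right[of x 0 0] by simp

lemma cinner_zero_left [simp]: "cinner 0 x = 0" for x :: "'h::chilbert_space"
  using cinner_scaleR_left[of 0 0 x] by simp

lemma cinner_minus_right: "cinner x (- y) = - cinner x y" for x y :: "'h::chilbert_space"
  using cinner_scaleR_right[of x "-1" y] by simp

lemma cinner_minus_left: "cinner (- x) y = - cinner x y" for x y :: "'h::chilbert_space"
  using cinner_scaleR_left[of "-1" x y] by simp

lemma cinner_diff_right: "cinner x (y - z) = cinner x y - cinner x z" for x y z :: "'h::chilbert_space"
  using cinner_add_right[of x y "-z"] by (simp add: cinner_minus_right)

lemma cinner_diff_left: "cinner (x - y) z = cinner x z - cinner y z" for x y z :: "'h::chilbert_space"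
  using cinner_add_left[of x "-y" z] by (simp add: cinner_minus_left)

lemmas cinner_simps = cinner_add_left cinner_add_right cinner_diff_left cinner_diff_right
  cinner_scaleR_left cinner_scaleR_right cinner_minus_left cinner_minus_right
  cinner_scaleC_left cinner_scaleC_right

lemma Re_cinner_commute: "Re (cinner x y) = Re (cinner y x)" for x y :: "'h::chilbert_space"
  by (metis cinner_commute complex_cnj_cnj complex_cnj complex_surj complex.sel(1) cnj.simps(1))

lemma Re_cinner_self: "Re (cinner x x) = (norm x)\<^sup>2" for x :: "'h::chilbert_space"
  using cinner_self_nonneg[of x]
  by (simp add: norm_eq_sqrt_cinner complex_nonneg_Reals_iff)

lemma norm_diff_sq: "(norm (x - y))\<^sup>2 = (norm x)\<^sup>2 - 2 * Re (cinner x y) + (norm y)\<^sup>2"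
  for x y :: "'h::chilbert_space"
  using Re_cinner_commute[of x y]
  by (simp add: Re_cinner_self[symmetric] cinner_simps)

lemma norm_add_sq: "(norm (x + y))\<^sup>2 = (norm x)\<^sup>2 + 2 * Re (cinner x y) + (norm y)\<^sup>2"
  for x y :: "'h::chilbert_space"
  using Re_cinner_commute[of x y]
  by (simp add: Re_cinner_self[symmetric] cinner_simps)

lemma Re_cinner_le: "Re (cinner x y) \<le> norm x * norm y" for x y :: "'h::chilbert_space"
proof -
  have "(norm (x + y))\<^sup>2 \<le> (norm x + norm y)\<^sup>2"
    by (intro power_mono norm_triangle_ineq norm_ge_zero)
  then show ?thesis
    unfolding norm_add_sq by (simp add: power2_sum)
qed

lemma abs_Re_cinner_le: "\<bar>Re (cinner x y)\<bar> \<le> norm x * norm y" for x y :: "'h::chilbert_space"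
  using Re_cinner_le[of x y] Re_cinner_le[of "-x" y] by (simp add: cinner_minus_left)

lemma cinner_eqI:
  fixes x z :: "'h::chilbert_space"
  assumes "\<And>y. Re (cinner x y) = Re (cinner z y)"
  shows "x = z"
proof -
  have "(norm (x - z))\<^sup>2 = 0"
    using assms[of "x - z"] by (simp add: Re_cinner_self[symmetric] cinner_diff_left)
  then show ?thesis by simp
qed

text \<open>Direct method: \<open>z\<close> is the limit of a minimising sequence of
  \<open>\<parallel>y\<parallel>\<^sup>2 - 2 f(y)\<close>, which is Cauchy by the parallelogram law.\<close>

lemma riesz_real:
  fixes f :: "'h::chilbert_space \<Rightarrow> real"
  assumes "bounded_linear f"
  obtains z where "\<And>y. f y = Re (cinner z y)"
proof -
  interpret f: bounded_linear f by fact
  define J where "J y = (norm y)\<^sup>2 - 2 * f y" for y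
  obtain K where K: "\<And>x. norm (f x) \<le> norm x * K"
    using f.bounded by blast
  have Jlow: "J y \<ge> - K\<^sup>2" for y
  proof -
    have "f y \<le> norm y * K" using K[of y] by simp
    moreover have "0 \<le> (norm y - K)\<^sup>2" by simp
    ultimately show ?thesis unfolding J_def by (simp add: power2_diff)
  qed
  define m where "m = Inf (range J)"
  have bdd: "bdd_below (range J)" using Jlow by (auto intro!: bdd_belowI)
  have mle: "m \<le> J y" for y unfolding m_def by (rule cInf_lower[OF _ bdd]) auto
  have "\<exists>y. J y < m + 1 / Suc n" for n
    using cInf_lessD[of "range J" "m + 1 / Suc n"] by (auto simp: m_def)
  then obtain w where w: "\<And>n. J (w n) < m + 1 / Suc n" by metis
  have par: "(norm (x - y))\<^sup>2 \<le> 2 * (J x - m) + 2 * (J y - m)" for x y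
  proof -
    have "4 * m \<le> 4 * J ((1/2) *\<^sub>R (x + y))" using mle by simp
    also have "\<dots> = (norm (x + y))\<^sup>2 - 4 * (f x + f y)"
      by (simp add: J_def f.scaleR f.add power_divide add_divide_distrib)
    finally show ?thesis
      unfolding J_def norm_add_sq norm_diff_sq by (simp add: algebra_simps)
  qed
  have "Cauchy w"
  proof (rule metric_CauchyI)
    fix e :: real assume e: "e > 0"
    obtain N where N: "4 / Suc N < e\<^sup>2"
    proof -
      obtain N where "inverse (Suc N) < e\<^sup>2 / 4"
        using reals_Archimedean[of "e\<^sup>2/4"] e by auto
      then show ?thesis by (intro that[of N]) (simp add: field_simps)
    qed
    have "dist (w i) (w j) < e" if "i \<ge> N" "j \<ge> N" for i j
    proof -
      have a: "1 / real (Suc k) \<le> 1 / Suc N" if "k \<ge> N" for k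
        using that by (simp add: field_simps)
      have "(norm (w i - w j))\<^sup>2 \<le> 2 * (J (w i) - m) + 2 * (J (w j) - m)" by (rule par)
      also have "\<dots> \<le> 4 / Suc N" using w[of i] w[of j] a[OF that(1)] a[OF that(2)] by simp
      also have "\<dots> < e\<^sup>2" by (rule N)
      finally show ?thesis using e by (simp add: dist_norm power_less_imp_less_base)
    qed
    then show "\<exists>M. \<forall>m\<ge>M. \<forall>n\<ge>M. dist (w m) (w n) < e" by blast
  qed
  then obtain z where z: "w \<longlonglongrightarrow> z" using Cauchy_convergent_iff convergent_def by blast
  have "(\<lambda>n. J (w n)) \<longlonglongrightarrow> J z"
    unfolding J_def by (intro tendsto_intros f.tendsto z)
  moreover have "(\<lambda>n. m + 1 / Suc n) \<longlonglongrightarrow> m + 0"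
    by (intro tendsto_intros LIMSEQ_inverse_real_of_nat[unfolded inverse_eq_divide])
  ultimately have "J z \<le> m + 0"
    by (rule LIMSEQ_le) (use w less_imp_le in blast)
  then have zmin: "J z \<le> J y" for y using mle[of y] by simp
  have "f y = Re (cinner z y)" for y
  proof (rule ccontr)
    define d where "d = f y - Re (cinner z y)"
    assume "f y \<noteq> Re (cinner z y)"
    then have d: "d \<noteq> 0" by (simp add: d_def)
    have q: "0 \<le> s\<^sup>2 * (norm y)\<^sup>2 - 2 * s * d" for s
      using zmin[of "z + s *\<^sub>R y"]
      by (simp add: J_def norm_add_sq d_def f.add f.scaleR cinner_scaleR_right power_mult_distrib algebra_simps)
    \<comment> \<open>The parabola in \<open>s\<close> is minimal at
      \<open>s = d / (norm y)\<^sup>2\<close>; the extra 1 keeps the step defined for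
      \<open>y = 0\<close> and still lets the linear term win.\<close>
    define b where "b = (norm y)\<^sup>2 + 1"
    have b: "b > 0" "(norm y)\<^sup>2 < b" by (auto simp: b_def add_nonneg_pos)
    have "(d / b)\<^sup>2 * (norm y)\<^sup>2 \<le> (d / b)\<^sup>2 * b" using b by (intro mult_left_mono) auto
    also have "\<dots> = d\<^sup>2 / b" using b by (simp add: power2_eq_square)
    finally have "0 \<le> d\<^sup>2 / b - 2 * (d\<^sup>2 / b)" using q[of "d / b"] by (simp add: power2_eq_square)
    moreover have "d\<^sup>2 / b > 0" using d b by simp
    ultimately show False by simp
  qed
  then show ?thesis using that by blast
qed

section \<open>Bounded operators\<close>

lemma bounded_opsD: "A \<in> bounded_ops \<Longrightarrow> blinfun_apply A (c *\<^sub>C x) = c *\<^sub>C blinfun_apply A x"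
  by (simp add: bounded_ops_def)

lemma scaleC_diff_right: "c *\<^sub>C (x - y) = c *\<^sub>C x - c *\<^sub>C y" for x y :: "'h::chilbert_space"
  by (rule linear_diff) (rule bounded_linear.linear[OF bounded_linear_scaleC])

lemma scaleC_scaleR: "c *\<^sub>C (r *\<^sub>R x) = r *\<^sub>R (c *\<^sub>C x)" for x :: "'h::chilbert_space"
  by (simp add: scaleR_scaleC scaleC_scaleC mult.commute)

lemma bounded_ops_closed:
  fixes A B :: "('h::chilbert_space) op"
  shows bounded_ops_id: "id_blinfun \<in> bounded_ops"
    and bounded_ops_zero: "0 \<in> bounded_ops"
    and bounded_ops_add: "A \<in> bounded_ops \<Longrightarrow> B \<in> bounded_ops \<Longrightarrow> A + B \<in> bounded_ops"
    and bounded_ops_diff: "A \<in> bounded_ops \<Longrightarrow> B \<in> bounded_ops \<Longrightarrow> A - B \<in> bounded_ops"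
    and bounded_ops_comp: "A \<in> bounded_ops \<Longrightarrow> B \<in> bounded_ops \<Longrightarrow> A o\<^sub>L B \<in> bounded_ops"
    and bounded_ops_scaleR: "A \<in> bounded_ops \<Longrightarrow> r *\<^sub>R A \<in> bounded_ops"
  unfolding bounded_ops_def using scaleR_scaleC[of 0 "0::'h"]
  by (auto simp: blinfun.add_left blinfun.diff_left blinfun.scaleR_left scaleC_add_right
      scaleC_diff_right scaleC_scaleR)
     (metis bounded_linear_scaleC linear_0 bounded_linear.linear)+

lemma bounded_ops_limit:
  assumes "\<And>n. A n \<in> bounded_ops" and "A \<longlonglongrightarrow> B"
  shows "B \<in> bounded_ops"
proof -
  have "blinfun_apply B (c *\<^sub>C x) = c *\<^sub>C blinfun_apply B x" for c x
  proof (rule LIMSEQ_unique)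
    show "(\<lambda>n. blinfun_apply (A n) (c *\<^sub>C x)) \<longlonglongrightarrow> blinfun_apply B (c *\<^sub>C x)"
      by (intro tendsto_intros assms)
    show "(\<lambda>n. blinfun_apply (A n) (c *\<^sub>C x)) \<longlonglongrightarrow> c *\<^sub>C blinfun_apply B x"
      using assms(1) by (simp add: bounded_opsD bounded_linear.tendsto[OF bounded_linear_scaleC]
          blinfun.tendsto[OF assms(2) tendsto_const])
  qed
  then show ?thesis by (simp add: bounded_ops_def)
qed

lemma cscale_op_of_real: "cscale_op (of_real r) A = r *\<^sub>R A"
  by (rule blinfun_eqI) (simp add: cscale_op.rep_eq scaleR_scaleC blinfun.scaleR_left)

text \<open>Riesz represents the real functional \<open>\<lambda>y. Re (cinner x (A y))\<close> by a
  vector \<open>g x\<close>. Complex linearity of \<open>A\<close> recovers the imaginary parts by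
  testing at \<open>\<i> *\<^sub>C y\<close>, and evaluating at \<open>y = g x\<close> bounds
  \<open>g\<close>.\<close>

lemma adjoint_exists:
  assumes "A \<in> bounded_ops"
  shows "\<exists>B. \<forall>x y. cinner (blinfun_apply B x) y = cinner x (blinfun_apply A y)"
proof -
  have bl: "bounded_linear (\<lambda>y. Re (cinner x (blinfun_apply A y)))" for x
  proof (rule bounded_linear_intro)
    show "norm (Re (cinner x (blinfun_apply A y))) \<le> norm y * (norm A * norm x)" for y
    proof -
      have "norm (Re (cinner x (blinfun_apply A y))) \<le> norm x * norm (blinfun_apply A y)"
        by (simp add: abs_Re_cinner_le)
      also have "\<dots> \<le> norm x * (norm A * norm y)"
        by (intro mult_left_mono norm_blinfun norm_ge_zero)
      finally show ?thesis by (simp add: mult.commute mult.left_commute)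
    qed
  qed (auto simp: blinfun.add_right blinfun.scaleR_right cinner_simps)
  have "\<exists>z. \<forall>y. Re (cinner x (blinfun_apply A y)) = Re (cinner z y)" for x
    using riesz_real[OF bl[of x]] by metis
  then obtain g where g: "\<And>x y. Re (cinner x (blinfun_apply A y)) = Re (cinner (g x) y)"
    by metis
  have g': "cinner (g x) y = cinner x (blinfun_apply A y)" for x y
  proof (rule complex_eqI)
    show "Re (cinner (g x) y) = Re (cinner x (blinfun_apply A y))" by (simp add: g)
    show "Im (cinner (g x) y) = Im (cinner x (blinfun_apply A y))"
      using g[of x "\<i> *\<^sub>C y"] by (simp add: bounded_opsD[OF assms] cinner_scaleC_right)
  qed
  have bg: "bounded_linear g"
  proof (rule bounded_linear_intro)
    show "g (x + y) = g x + g y" for x y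
      by (rule cinner_eqI) (simp add: g' cinner_simps)
    show "g (r *\<^sub>R x) = r *\<^sub>R g x" for r x
      by (rule cinner_eqI) (simp add: g' cinner_simps)
    show "norm (g x) \<le> norm x * norm A" for x
    proof -
      have "(norm (g x))\<^sup>2 = Re (cinner x (blinfun_apply A (g x)))"
        by (simp add: Re_cinner_self[symmetric] g')
      also have "\<dots> \<le> norm x * norm (blinfun_apply A (g x))" by (rule Re_cinner_le)
      also have "\<dots> \<le> norm x * (norm A * norm (g x))"
        by (intro mult_left_mono norm_blinfun norm_ge_zero)
      finally have "norm (g x) * norm (g x) \<le> (norm x * norm A) * norm (g x)"
        by (simp add: power2_eq_square mult.assoc)
      then show ?thesis by (cases "norm (g x) = 0") (auto simp: mult_le_cancel_right)
    qed
  qed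
  show ?thesis
    by (rule exI[of _ "Blinfun g"]) (simp add: bounded_linear_Blinfun_apply[OF bg] g')
qed

lemma adj_eqI:
  assumes "\<And>x y. cinner (blinfun_apply B x) y = cinner x (blinfun_apply A y)"
  shows "adj A = B"
  unfolding adj_def
proof (rule the_equality)
  show "C = B" if "\<forall>x y. cinner (blinfun_apply C x) y = cinner x (blinfun_apply A y)" for C
    by (rule blinfun_eqI, rule cinner_eqI) (simp add: assms that)
qed (use assms in blast)

lemma cinner_adj:
  assumes "A \<in> bounded_ops"
  shows "cinner (blinfun_apply (adj A) x) y = cinner x (blinfun_apply A y)"
  using adjoint_exists[OF assms] adj_eqI by metis

lemma cinner_adj_right:
  assumes "A \<in> bounded_ops"
  shows "cinner x (blinfun_apply (adj A) y) = cinner (blinfun_apply A x) y"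
  by (metis assms cinner_adj cinner_commute)

text \<open>Phrased by the inner product instead of \<open>adj A = A\<close>, so that the algebraic
  closure rules need no appeal to a definite description.\<close>

definition hermitian :: "('h::chilbert_space) op \<Rightarrow> bool" where
  "hermitian A \<longleftrightarrow> A \<in> bounded_ops \<and>
     (\<forall>x y. cinner (blinfun_apply A x) y = cinner x (blinfun_apply A y))"

lemma hermitian_bounded_ops: "hermitian A \<Longrightarrow> A \<in> bounded_ops"
  by (simp add: hermitian_def)

lemma hermitian_cinner: "hermitian A \<Longrightarrow> cinner (blinfun_apply A x) y = cinner x (blinfun_apply A y)"
  by (simp add: hermitian_def)

lemma hermitian_adj: "hermitian A \<Longrightarrow> adj A = A"
  by (rule adj_eqI) (simp add: hermitian_def)

lemma projection_hermitian: "projection P \<Longrightarrow> hermitian P"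
  unfolding projection_def hermitian_def by (metis cinner_adj)

lemma hermitian_closed:
  shows hermitian_id: "hermitian id_blinfun"
    and hermitian_zero: "hermitian 0"
    and hermitian_add: "hermitian A \<Longrightarrow> hermitian B \<Longrightarrow> hermitian (A + B)"
    and hermitian_diff: "hermitian A \<Longrightarrow> hermitian B \<Longrightarrow> hermitian (A - B)"
    and hermitian_scaleR: "hermitian A \<Longrightarrow> hermitian (r *\<^sub>R A)"
    and hermitian_comp: "hermitian A \<Longrightarrow> hermitian B \<Longrightarrow> A o\<^sub>L B = B o\<^sub>L A \<Longrightarrow> hermitian (A o\<^sub>L B)"
proof -
  show "hermitian (A o\<^sub>L B)" if "hermitian A" "hermitian B" and c: "A o\<^sub>L B = B o\<^sub>L A"
  proof -
    have "cinner (blinfun_apply (A o\<^sub>L B) x) y = cinner x (blinfun_apply (B o\<^sub>L A) y)" for x y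
      using that(1,2) by (simp add: hermitian_def)
    then show ?thesis using that by (simp add: hermitian_def bounded_ops_closed)
  qed
qed (auto simp: hermitian_def bounded_ops_closed blinfun.add_left blinfun.diff_left
    blinfun.scaleR_left cinner_simps)

lemma tendsto_cinner_right:
  fixes f :: "'b \<Rightarrow> 'h::chilbert_space"
  assumes "(f \<longlongrightarrow> y) F"
  shows "((\<lambda>n. Re (cinner x (f n))) \<longlongrightarrow> Re (cinner x y)) F"
proof -
  have "bounded_linear (\<lambda>y. Re (cinner x y))"
    by (rule bounded_linear_intro[where K = "norm x"])
       (auto simp: cinner_simps abs_Re_cinner_le mult.commute[of _ "norm x"])
  then show ?thesis using assms by (rule bounded_linear.tendsto)
qed

lemma hermitian_limit:
  assumes "\<And>n. hermitian (A n)" and lim: "A \<longlonglongrightarrow> B"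
  shows "hermitian B"
proof -
  have bd: "B \<in> bounded_ops" using assms bounded_ops_limit hermitian_bounded_ops by blast
  have "blinfun_apply (adj B) x = blinfun_apply B x" for x
  proof (rule cinner_eqI)
    fix y
    have l: "(\<lambda>n. blinfun_apply (A n) z) \<longlonglongrightarrow> blinfun_apply B z" for z
      by (rule blinfun.tendsto[OF lim tendsto_const])
    have "(\<lambda>n. Re (cinner x (blinfun_apply (A n) y))) \<longlonglongrightarrow> Re (cinner x (blinfun_apply B y))"
      by (rule tendsto_cinner_right[OF l])
    moreover have "(\<lambda>n. Re (cinner y (blinfun_apply (A n) x))) \<longlonglongrightarrow> Re (cinner y (blinfun_apply B x))"
      by (rule tendsto_cinner_right[OF l])
    moreover have "Re (cinner x (blinfun_apply (A n) y)) = Re (cinner y (blinfun_apply (A n) x))" for n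
      by (metis Re_cinner_commute assms(1) hermitian_cinner)
    ultimately have "Re (cinner x (blinfun_apply B y)) = Re (cinner y (blinfun_apply B x))"
      using LIMSEQ_unique by auto
    then show "Re (cinner (blinfun_apply (adj B) x) y) = Re (cinner (blinfun_apply B x) y)"
      by (simp add: cinner_adj[OF bd] Re_cinner_commute[of "blinfun_apply B x"])
  qed
  then have "adj B = B" by (intro blinfun_eqI)
  then show ?thesis using bd unfolding hermitian_def by (metis cinner_adj)
qed

lemma hermitian_cinner_self:
  assumes "hermitian A"
  shows "cinner x (blinfun_apply A x) = of_real (Re (cinner x (blinfun_apply A x)))"
proof -
  have "cinner x (blinfun_apply A x) = cnj (cinner x (blinfun_apply A x))"
    by (metis assms cinner_commute hermitian_cinner)
  then show ?thesis by (simp add: complex_eq_iff)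
qed

text \<open>Self-adjointness comes by polarisation: reality of the quadratic form at
  \<open>x + y\<close> relates the imaginary parts of the two mixed terms, and replacing
  \<open>y\<close> by \<open>\<i> *\<^sub>C y\<close> relates their real parts.\<close>

lemma positive_op_iff_hermitian:
  "positive_op A \<longleftrightarrow> hermitian A \<and> (\<forall>x. 0 \<le> Re (cinner x (blinfun_apply A x)))"
proof
  assume A: "hermitian A \<and> (\<forall>x. 0 \<le> Re (cinner x (blinfun_apply A x)))"
  then show "positive_op A"
    unfolding positive_op_def
    by (metis hermitian_bounded_ops hermitian_cinner_self nonneg_Reals_of_real_iff)
next
  assume A: "positive_op A"
  then have bd: "A \<in> bounded_ops" and pos: "\<And>x. cinner x (blinfun_apply A x) \<in> \<real>\<^sub>\<ge>\<^sub>0"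
    by (auto simp: positive_op_def)
  have re: "Im (cinner x (blinfun_apply A x)) = 0" for x
    using pos[of x] by (simp add: complex_nonneg_Reals_iff)
  have im: "Im (cinner x (blinfun_apply A y)) + Im (cinner y (blinfun_apply A x)) = 0" for x y
    using re[of "x + y"] re[of x] re[of y] by (simp add: blinfun.add_right cinner_simps)
  have real: "Re (cinner x (blinfun_apply A y)) = Re (cinner y (blinfun_apply A x))" for x y
    using im[of x "\<i> *\<^sub>C y"] by (simp add: bounded_opsD[OF bd] cinner_simps)
  have "cinner (blinfun_apply A x) y = cinner x (blinfun_apply A y)" for x y
    unfolding cinner_commute[of "blinfun_apply A x" y]
    using im[of x y] real[of x y] by (simp add: complex_eq_iff)
  then show "hermitian A \<and> (\<forall>x. 0 \<le> Re (cinner x (blinfun_apply A x)))"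
    using bd pos by (auto simp: hermitian_def complex_nonneg_Reals_iff)
qed

lemma norm_sq_hermitian:
  "hermitian A \<Longrightarrow> (norm (blinfun_apply A x))\<^sup>2 = Re (cinner x (blinfun_apply (A o\<^sub>L A) x))"
  by (simp add: Re_cinner_self[symmetric] hermitian_cinner)

lemma positive_op_square: "hermitian A \<Longrightarrow> positive_op (A o\<^sub>L A)"
  unfolding positive_op_iff_hermitian
  by (metis hermitian_comp norm_sq_hermitian zero_le_power2)

lemma hermitian_square_zero:
  assumes "hermitian A" and "A o\<^sub>L A = 0"
  shows "A = 0"
proof (rule blinfun_eqI)
  show "blinfun_apply A x = blinfun_apply 0 x" for x
    using norm_sq_hermitian[OF assms(1), of x] by (simp add: assms(2))
qed

lemma abs_cinner_apply_le: "\<bar>Re (cinner x (blinfun_apply A x))\<bar> \<le> norm A * (norm x)\<^sup>2"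
proof -
  have "\<bar>Re (cinner x (blinfun_apply A x))\<bar> \<le> norm x * norm (blinfun_apply A x)"
    by (rule abs_Re_cinner_le)
  also have "\<dots> \<le> norm x * (norm A * norm x)" by (intro mult_left_mono norm_blinfun) simp
  finally show ?thesis by (simp add: power2_eq_square algebra_simps)
qed

text \<open>The bridge from norm estimates, which the polynomial calculus delivers, to positivity,
  which the trace understands.\<close>

lemma positive_op_shift:
  assumes "hermitian A" and "norm A \<le> c"
  shows "positive_op (c *\<^sub>R id_blinfun + A)"
proof -
  have "0 \<le> Re (cinner x (blinfun_apply (c *\<^sub>R id_blinfun + A) x))" for x
  proof -
    have "norm A * (norm x)\<^sup>2 \<le> c * (norm x)\<^sup>2" using assms(2) by (intro mult_right_mono) auto
    then show ?thesis
      using abs_cinner_apply_le[of x A]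
      by (simp add: blinfun.add_left blinfun.scaleR_left cinner_simps Re_cinner_self)
  qed
  then show ?thesis
    unfolding positive_op_iff_hermitian using assms by (simp add: hermitian_closed)
qed

section \<open>Polynomial functional calculus\<close>

lemma poly_op_altdef:
  assumes "degree q \<le> n"
  shows "poly_op q A = (\<Sum>i\<le>n. coeff q i *\<^sub>R (((o\<^sub>L) A ^^ i) id_blinfun))"
  unfolding poly_op_def
  by (rule sum.mono_neutral_left) (use assms in \<open>auto simp: coeff_eq_0\<close>)

lemma poly_op_pCons: "poly_op (pCons a q) A = a *\<^sub>R id_blinfun + (A o\<^sub>L poly_op q A)"
proof -
  have "poly_op (pCons a q) A = (\<Sum>i\<le>Suc (degree q). coeff (pCons a q) i *\<^sub>R (((o\<^sub>L) A ^^ i) id_blinfun))"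
    by (rule poly_op_altdef) (rule degree_pCons_le)
  also have "\<dots> = a *\<^sub>R id_blinfun + (\<Sum>i\<le>degree q. coeff q i *\<^sub>R (A o\<^sub>L ((o\<^sub>L) A ^^ i) id_blinfun))"
    by (subst sum.atMost_Suc_shift) simp
  also have "(\<Sum>i\<le>degree q. coeff q i *\<^sub>R (A o\<^sub>L ((o\<^sub>L) A ^^ i) id_blinfun)) = A o\<^sub>L poly_op q A"
    unfolding poly_op_def
    by (simp add: bounded_bilinear.sum_right[OF bounded_bilinear_blinfun_compose]
        bounded_bilinear.scaleR_right[OF bounded_bilinear_blinfun_compose])
  finally show ?thesis .
qed

lemmas blinfun_compose_simps =
  bounded_bilinear.add_left[OF bounded_bilinear_blinfun_compose]
  bounded_bilinear.add_right[OF bounded_bilinear_blinfun_compose]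
  bounded_bilinear.diff_left[OF bounded_bilinear_blinfun_compose]
  bounded_bilinear.diff_right[OF bounded_bilinear_blinfun_compose]
  bounded_bilinear.scaleR_left[OF bounded_bilinear_blinfun_compose]
  bounded_bilinear.scaleR_right[OF bounded_bilinear_blinfun_compose]
  bounded_bilinear.minus_left[OF bounded_bilinear_blinfun_compose]
  bounded_bilinear.minus_right[OF bounded_bilinear_blinfun_compose]

lemma blinfun_compose_id [simp]: "A o\<^sub>L id_blinfun = A" "id_blinfun o\<^sub>L A = A"
  by (auto intro!: blinfun_eqI)

lemma blinfun_compose_assoc: "(A o\<^sub>L B) o\<^sub>L C = A o\<^sub>L (B o\<^sub>L C)"
  by (rule blinfun_eqI) simp

lemma poly_op_0 [simp]: "poly_op 0 A = 0"
  by (simp add: poly_op_def)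

lemma poly_op_const [simp]: "poly_op [:a:] A = a *\<^sub>R id_blinfun"
  by (simp add: poly_op_pCons)

lemma poly_op_add: "poly_op (q + r) A = poly_op q A + poly_op r A"
proof -
  let ?n = "max (degree q) (degree r)"
  have "degree (q + r) \<le> ?n" by (rule degree_add_le) auto
  then show ?thesis
    by (simp add: poly_op_altdef[of _ ?n] scaleR_add_left sum.distrib)
qed

lemma poly_op_smult: "poly_op (smult c q) A = c *\<^sub>R poly_op q A"
  by (induction q) (simp_all add: poly_op_pCons blinfun_compose_simps scaleR_add_right)

lemma poly_op_diff: "poly_op (q - r) A = poly_op q A - poly_op r A"
  using poly_op_add[of "q - r" r A] by simp

lemma poly_op_mult: "poly_op (q * r) A = poly_op q A o\<^sub>L poly_op r A"
proof (induction q)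
  case (pCons a q)
  then show ?case
    by (simp add: mult_pCons_left poly_op_add poly_op_smult poly_op_pCons blinfun_compose_simps blinfun_compose_assoc)
qed simp

lemma poly_op_pcompose: "poly_op (pcompose q r) A = poly_op q (poly_op r A)"
  by (induction q) (simp_all add: pcompose_pCons poly_op_add poly_op_mult poly_op_pCons)

lemma poly_op_commute: "poly_op q A o\<^sub>L poly_op r A = poly_op r A o\<^sub>L poly_op q A"
  by (metis mult.commute poly_op_mult)

lemma poly_op_X [simp]: "poly_op [:0, 1:] A = A"
  by (simp add: poly_op_pCons)

lemma poly_op_X_square [simp]: "poly_op [:0, 0, 1:] A = A o\<^sub>L A"
  by (simp add: poly_op_pCons)

lemma hermitian_poly_op:
  assumes "hermitian A"
  shows "hermitian (poly_op q A)"
proof (induction q)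
  case (pCons a q)
  have "A o\<^sub>L poly_op q A = poly_op q A o\<^sub>L A"
    using poly_op_commute[of "[:0,1:]" A q] by simp
  then show ?case
    using assms pCons by (simp add: poly_op_pCons hermitian_closed)
qed (simp add: hermitian_closed)

section \<open>Spectra of hermitian operators\<close>

text \<open>The inverse is the Neumann series. Powers of \<open>C\<close> commute with
  \<open>C\<close>, so the partial sums telescope on either side and one limit inverts from
  both.\<close>

lemma neumann_inverse:
  assumes "C \<in> bounded_ops" and "norm C < 1"
  shows "\<exists>B\<in>bounded_ops. (id_blinfun - C) o\<^sub>L B = id_blinfun \<and> B o\<^sub>L (id_blinfun - C) = id_blinfun"
proof -
  define a where "a n = ((o\<^sub>L) C ^^ n) id_blinfun" for n
  have a_Suc: "a (Suc n) = C o\<^sub>L a n" for n by (simp add: a_def)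
  have a_Suc': "a (Suc n) = a n o\<^sub>L C" for n
    by (induction n) (simp_all add: a_Suc blinfun_compose_assoc[symmetric], simp add: a_def)
  have norm_a: "norm (a n) \<le> norm C ^ n" for n
  proof (induction n)
    case 0
    then show ?case using norm_blinfun_id_le by (simp add: a_def)
  next
    case (Suc n)
    have "norm (a (Suc n)) \<le> norm C * norm (a n)" unfolding a_Suc by (rule norm_blinfun_compose)
    also have "\<dots> \<le> norm C * norm C ^ n" using Suc by (intro mult_left_mono) auto
    finally show ?case by simp
  qed
  have "summable a"
  proof (rule summable_comparison_test)
    show "summable (\<lambda>n. norm C ^ n)" using assms by (intro summable_geometric) simp
  qed (use norm_a in auto)
  then have s: "(\<lambda>n. \<Sum>i<n. a i) \<longlonglongrightarrow> suminf a" by (rule summable_LIMSEQ)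
  have a0: "a \<longlonglongrightarrow> 0" by (rule summable_LIMSEQ_zero) fact
  have a_bd: "a n \<in> bounded_ops" for n
    by (induction n) (use assms in \<open>auto simp: a_def bounded_ops_closed\<close>)
  have tele: "(id_blinfun - C) o\<^sub>L (\<Sum>i<n. a i) = id_blinfun - a n"
             "(\<Sum>i<n. a i) o\<^sub>L (id_blinfun - C) = id_blinfun - a n" for n
  proof (induction n)
    case (Suc n)
    { case 1 show ?case using Suc(1) by (simp add: blinfun_compose_simps a_Suc) }
    { case 2
      have "(\<Sum>i<Suc n. a i) o\<^sub>L (id_blinfun - C)
          = ((\<Sum>i<n. a i) o\<^sub>L (id_blinfun - C)) + (a n - a (Suc n))"
        by (simp add: blinfun_compose_simps a_Suc')
      then show ?case using Suc(2) by simp }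
  qed (simp_all add: a_def)
  have lim: "(\<lambda>n. id_blinfun - a n) \<longlonglongrightarrow> id_blinfun - 0"
    by (intro tendsto_intros a0)
  have "(\<lambda>n. (id_blinfun - C) o\<^sub>L (\<Sum>i<n. a i)) \<longlonglongrightarrow> ((id_blinfun - C) o\<^sub>L suminf a)"
    by (intro bounded_bilinear.tendsto[OF bounded_bilinear_blinfun_compose] tendsto_const s)
  then have "(id_blinfun - C) o\<^sub>L suminf a = id_blinfun"
    using LIMSEQ_unique[OF _ lim] by (simp add: tele)
  moreover have "(\<lambda>n. (\<Sum>i<n. a i) o\<^sub>L (id_blinfun - C)) \<longlonglongrightarrow> (suminf a o\<^sub>L (id_blinfun - C))"
    by (intro bounded_bilinear.tendsto[OF bounded_bilinear_blinfun_compose] tendsto_const s)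
  then have "suminf a o\<^sub>L (id_blinfun - C) = id_blinfun"
    using LIMSEQ_unique[OF _ lim] by (simp add: tele)
  moreover have "suminf a \<in> bounded_ops"
  proof (rule bounded_ops_limit[OF _ s])
    show "(\<Sum>i<n. a i) \<in> bounded_ops" for n
      by (induction n) (auto simp: bounded_ops_closed a_bd)
  qed
  ultimately show ?thesis by blast
qed

text \<open>The set on which \<open>cfc\<close> demands uniform convergence. Non-real spectral
  points never have to be discussed: irreducible quadratic factors are estimated directly.\<close>

definition real_spectrum :: "('h::chilbert_space) op \<Rightarrow> real set" where
  "real_spectrum A = {t. complex_of_real t \<in> spectrum A}"

text \<open>The free scale \<open>e\<close> is chosen to make \<open>1 - e (A - t)\<close> a
  contraction: \<open>- 1 / t\<close> for \<open>t\<close> beyond the norm, a small positive number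
  for negative \<open>t\<close> and positive \<open>A\<close>.\<close>

lemma not_in_real_spectrumI:
  assumes "A \<in> bounded_ops" and "norm (id_blinfun - e *\<^sub>R (A - t *\<^sub>R id_blinfun)) < 1"
  shows "t \<notin> real_spectrum A"
proof -
  let ?D = "A - t *\<^sub>R id_blinfun"
  have "id_blinfun - e *\<^sub>R ?D \<in> bounded_ops" using assms by (simp add: bounded_ops_closed)
  from neumann_inverse[OF this assms(2)] obtain B where B: "B \<in> bounded_ops"
    "(e *\<^sub>R ?D) o\<^sub>L B = id_blinfun" "B o\<^sub>L (e *\<^sub>R ?D) = id_blinfun"
    by auto
  have "?D o\<^sub>L (e *\<^sub>R B) = id_blinfun" "(e *\<^sub>R B) o\<^sub>L ?D = id_blinfun"
    using B(2,3) by (simp_all add: blinfun_compose_simps scaleR_diff_right mult.commute)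
  then show ?thesis
    using B(1) unfolding real_spectrum_def spectrum_def
    by (auto intro!: bexI[of _ "e *\<^sub>R B"] simp: bounded_ops_closed cscale_op_of_real)
qed

lemma real_spectrum_bound:
  assumes "A \<in> bounded_ops" and "t \<in> real_spectrum A"
  shows "\<bar>t\<bar> \<le> norm A"
proof (rule ccontr)
  assume t: "\<not> \<bar>t\<bar> \<le> norm A"
  then have t0: "t \<noteq> 0" by auto
  have "id_blinfun - (- 1 / t) *\<^sub>R (A - t *\<^sub>R id_blinfun) = (1 / t) *\<^sub>R A"
    using t0 by (simp add: scaleR_diff_right)
  moreover have "norm ((1 / t) *\<^sub>R A) < 1" using t t0 by (simp add: divide_simps)
  ultimately show False using not_in_real_spectrumI[OF assms(1), of "-1/t" t] assms(2) by simp
qed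

text \<open>The Lax--Milgram argument: for \<open>t < 0\<close> and small \<open>e > 0\<close> the operator
  \<open>1 - e (A - t)\<close> is a strict contraction.\<close>

lemma real_spectrum_positive:
  assumes "positive_op A" and "t \<in> real_spectrum A"
  shows "0 \<le> t"
proof (rule ccontr)
  assume t: "\<not> 0 \<le> t"
  let ?D = "A - t *\<^sub>R id_blinfun"
  define K where "K = norm ?D + \<bar>t\<bar>"
  have K: "K > 0" "norm ?D \<le> K" "- t \<le> K" using t norm_ge_zero[of ?D] unfolding K_def by linarith+
  \<comment> \<open>The squared contraction factor is at most
    \<open>1 + 2 * e * t + e\<^sup>2 * K\<^sup>2\<close>; this \<open>e\<close> minimises it and
    \<open>k\<close> is the minimum. The summand \<open>\<bar>t\<bar>\<close> in \<open>K\<close>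
    ensures \<open>0 \<le> k\<close>.\<close>
  define e where "e = - t / K\<^sup>2"
  have e: "e > 0" using t K by (simp add: e_def divide_neg_pos)
  define k where "k = 1 - t\<^sup>2 / K\<^sup>2"
  have "(-t)\<^sup>2 \<le> K\<^sup>2" using t K by (intro power_mono) auto
  then have k: "0 \<le> k" "k < 1" using t K by (auto simp: k_def field_simps)
  have contr: "norm (blinfun_apply (id_blinfun - e *\<^sub>R ?D) x) \<le> sqrt k * norm x" for x
  proof -
    have pos: "0 \<le> Re (cinner x (blinfun_apply A x))"
      using assms(1) by (simp add: positive_op_iff_hermitian)
    have D: "- t * (norm x)\<^sup>2 \<le> Re (cinner x (blinfun_apply ?D x))"
      using pos by (simp add: blinfun.diff_left blinfun.scaleR_left cinner_simps Re_cinner_self)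
    have "norm (blinfun_apply ?D x) \<le> norm ?D * norm x" by (rule norm_blinfun)
    also have "\<dots> \<le> K * norm x" using K by (intro mult_right_mono) auto
    finally have ND: "(norm (blinfun_apply ?D x))\<^sup>2 \<le> (K * norm x)\<^sup>2"
      by (intro power_mono) auto
    have "(norm (blinfun_apply (id_blinfun - e *\<^sub>R ?D) x))\<^sup>2
        = (norm x)\<^sup>2 - 2 * (e * Re (cinner x (blinfun_apply ?D x))) + e\<^sup>2 * (norm (blinfun_apply ?D x))\<^sup>2"
      by (simp add: blinfun.diff_left[of id_blinfun] blinfun.scaleR_left[of e] norm_diff_sq
          cinner_scaleR_right power_mult_distrib)
    also have "\<dots> \<le> (norm x)\<^sup>2 - 2 * (e * (- t * (norm x)\<^sup>2)) + e\<^sup>2 * (K * norm x)\<^sup>2"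
      using e D ND by (intro add_mono diff_mono mult_left_mono) auto
    also have "\<dots> = k * (norm x)\<^sup>2"
      using K by (simp add: e_def k_def field_simps power2_eq_square)
    finally have "sqrt ((norm (blinfun_apply (id_blinfun - e *\<^sub>R ?D) x))\<^sup>2) \<le> sqrt (k * (norm x)\<^sup>2)"
      by (rule real_sqrt_le_mono)
    then show ?thesis by (simp add: real_sqrt_mult)
  qed
  have "norm (id_blinfun - e *\<^sub>R ?D) \<le> sqrt k"
    by (rule norm_blinfun_bound) (use k contr in auto)
  also have "\<dots> < 1" using k by simp
  finally show False
    using not_in_real_spectrumI[of A e t] assms by (simp add: positive_op_def)
qed

text \<open>A substitute for invertibility that passes to compositions without any surjectivity
  argument.\<close>

definition bounded_below :: "('h::chilbert_space) op \<Rightarrow> bool" where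
  "bounded_below A \<longleftrightarrow> (\<exists>c>0. \<forall>x. c * norm x \<le> norm (blinfun_apply A x))"

lemma bounded_below_compose:
  assumes "bounded_below A" "bounded_below B"
  shows "bounded_below (A o\<^sub>L B)"
proof -
  obtain a b where a: "a > 0" "\<And>x. a * norm x \<le> norm (blinfun_apply A x)"
    and b: "b > 0" "\<And>x. b * norm x \<le> norm (blinfun_apply B x)"
    using assms unfolding bounded_below_def by blast
  have "a * b * norm x \<le> norm (blinfun_apply (A o\<^sub>L B) x)" for x
  proof -
    have "a * b * norm x \<le> a * norm (blinfun_apply B x)" using a(1) b(2)[of x] by (simp add: mult.assoc)
    also have "\<dots> \<le> norm (blinfun_apply A (blinfun_apply B x))" by (rule a)
    finally show ?thesis by simp
  qed
  then show ?thesis unfolding bounded_below_def using a(1) b(1) by (intro exI[of _ "a * b"]) auto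
qed

lemma bounded_below_not_spectrum:
  assumes "t \<notin> real_spectrum A"
  shows "bounded_below (A - t *\<^sub>R id_blinfun)"
proof -
  let ?D = "A - t *\<^sub>R id_blinfun"
  obtain B where B: "B o\<^sub>L ?D = id_blinfun"
    using assms unfolding real_spectrum_def spectrum_def by (auto simp: cscale_op_of_real)
  \<comment> \<open>On the trivial space \<open>norm B\<close> is 0; adding 1 keeps the constant
    positive.\<close>
  have "1 / (norm B + 1) * norm x \<le> norm (blinfun_apply ?D x)" for x
  proof -
    have "norm x = norm (blinfun_apply B (blinfun_apply ?D x))"
      by (metis B blinfun_apply_blinfun_compose blinfun_apply_id_blinfun)
    also have "\<dots> \<le> norm B * norm (blinfun_apply ?D x)" by (rule norm_blinfun)
    also have "\<dots> \<le> (norm B + 1) * norm (blinfun_apply ?D x)" by (intro mult_right_mono) auto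
    finally show ?thesis by (simp add: pos_divide_le_eq add_nonneg_pos mult.commute)
  qed
  then show ?thesis unfolding bounded_below_def by (intro exI[of _ "1 / (norm B + 1)"]) (simp add: add_nonneg_pos)
qed

text \<open>The polynomial is \<open>(t - a)\<^sup>2 + b\<^sup>2\<close>, with roots
  \<open>a \<plusminus> \<i> b\<close>. The square of a hermitian operator is positive, so
  \<open>b\<^sup>2\<close> survives as a lower bound. This is the polynomial form of the reality of
  the spectrum.\<close>

lemma bounded_below_quadratic:
  assumes "hermitian A" and "b \<noteq> 0"
  shows "bounded_below (poly_op [:a\<^sup>2 + b\<^sup>2, - 2 * a, 1:] A)"
proof -
  define D where "D = A - a *\<^sub>R id_blinfun"
  have hD: "hermitian D" using assms by (simp add: D_def hermitian_closed)
  have eq: "poly_op [:a\<^sup>2 + b\<^sup>2, - 2 * a, 1:] A = (D o\<^sub>L D) + b\<^sup>2 *\<^sub>R id_blinfun"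
    by (simp add: poly_op_pCons D_def blinfun_compose_simps power2_eq_square algebra_simps)
       (simp add: scaleR_add_left[symmetric])
  have "b\<^sup>2 * norm x \<le> norm (blinfun_apply (poly_op [:a\<^sup>2 + b\<^sup>2, - 2 * a, 1:] A) x)" (is "_ \<le> norm ?y") for x
  proof -
    have "b\<^sup>2 * (norm x)\<^sup>2 \<le> (norm (blinfun_apply D x))\<^sup>2 + b\<^sup>2 * (norm x)\<^sup>2" by simp
    also have "\<dots> = Re (cinner x ?y)"
      unfolding eq norm_sq_hermitian[OF hD]
      by (simp only: blinfun.add_left blinfun.scaleR_left cinner_simps)
         (simp add: Re_cinner_self)
    also have "\<dots> \<le> norm x * norm ?y" by (rule Re_cinner_le)
    finally have "norm x * (b\<^sup>2 * norm x) \<le> norm x * norm ?y"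
      by (simp add: power2_eq_square algebra_simps)
    then show ?thesis by (cases "norm x = 0") (auto simp: mult_le_cancel_left)
  qed
  then show ?thesis unfolding bounded_below_def using assms(2) by (intro exI[of _ "b\<^sup>2"]) simp
qed

text \<open>Any complex root \<open>z\<close> is non-real here. Division by the real quadratic with
  roots \<open>z\<close> and its conjugate leaves a real remainder of degree at most 1 that vanishes
  at \<open>z\<close>, which must be 0.\<close>

lemma real_poly_quadratic_factor:
  fixes r :: "real poly"
  assumes "degree r > 0" and "\<And>t. poly r t \<noteq> 0"
  obtains a b s where "b \<noteq> 0" "r = [:a\<^sup>2 + b\<^sup>2, - 2 * a, 1:] * s"
proof -
  define ev where "ev q z = poly (map_poly complex_of_real q) z" for q z
  have ev_pCons: "ev (pCons c q) z = of_real c + z * ev q z" for c q z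
    by (simp add: ev_def map_poly_pCons)
  have ev_0: "ev 0 z = 0" for z by (simp add: ev_def)
  have ev_add: "ev (q + q') z = ev q z + ev q' z" for q q' z
  proof (induction q q' rule: poly_induct2)
    case (pCons a p b q)
    then show ?case by (simp add: ev_pCons algebra_simps)
  qed (simp add: ev_0)
  have ev_smult: "ev (smult c q) z = of_real c * ev q z" for c q z
    by (induction q) (simp_all add: ev_pCons ev_0 algebra_simps)
  have ev_mult: "ev (q * q') z = ev q z * ev q' z" for q q' z
    by (induction q) (simp_all add: ev_pCons ev_0 ev_add ev_smult mult_pCons_left algebra_simps)
  have "degree (map_poly complex_of_real r) > 0" using assms(1) by (simp add: degree_map_poly)
  then have "\<not> constant (poly (map_poly complex_of_real r))" by (simp add: constant_degree)
  then obtain z where z: "ev r z = 0"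
    using fundamental_theorem_of_algebra unfolding ev_def by blast
  have ev_real: "ev q (of_real t) = of_real (poly q t)" for q t
    by (induction q) (simp_all add: ev_pCons ev_0)
  define a b where "a = Re z" and "b = Im z"
  have b: "b \<noteq> 0"
  proof
    assume "b = 0"
    then have "z = of_real a" by (simp add: a_def b_def complex_eq_iff)
    then show False using z assms(2)[of a] by (simp add: ev_real)
  qed
  define d where "d = [:a\<^sup>2 + b\<^sup>2, - 2 * a, 1:]"
  have evd: "ev d z = 0"
    unfolding d_def
    by (simp add: ev_pCons ev_0 a_def b_def complex_eq_iff power2_eq_square algebra_simps)
  define m where "m = r mod d"
  have rd: "r = d * (r div d) + m" by (simp add: m_def)
  have m0: "ev m z = 0" using z evd arg_cong[OF rd, of "\<lambda>q. ev q z"] by (simp add: ev_add ev_mult)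
  have "degree m \<le> 1"
    using degree_mod_less[of d r] by (auto simp: m_def d_def)
  then have mm: "m = [:coeff m 0, coeff m 1:]"
    by (intro poly_eqI) (auto simp: coeff_pCons coeff_eq_0 split: nat.split)
  have "ev m z = of_real (coeff m 0) + z * of_real (coeff m 1)"
    by (subst mm) (simp add: ev_pCons ev_0)
  then have "coeff m 1 = 0" "coeff m 0 = 0" using m0 b by (auto simp: complex_eq_iff b_def)
  then have "m = 0" using mm by simp
  then show ?thesis using that[OF b, of a "r div d"] rd by (simp add: d_def)
qed

text \<open>Half of a spectral mapping theorem, by splitting off one factor at a time: a linear one
  whose root lies outside the spectrum, or an irreducible quadratic.\<close>

lemma bounded_below_poly_op:
  assumes "hermitian A" and "r \<noteq> 0" and "\<And>t. t \<in> real_spectrum A \<Longrightarrow> poly r t \<noteq> 0"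
  shows "bounded_below (poly_op r A)"
  using assms(2,3)
proof (induction "degree r" arbitrary: r rule: less_induct)
  case less
  consider "degree r = 0" | t where "poly r t = 0" | "degree r > 0" "\<And>t. poly r t \<noteq> 0" by blast
  then show ?case
  proof cases
    case 1
    then obtain c where c: "r = [:c:]" by (metis degree_eq_zeroE)
    then have "c \<noteq> 0" using less by auto
    then show ?thesis unfolding bounded_below_def c
      by (intro exI[of _ "\<bar>c\<bar>"]) (simp add: blinfun.scaleR_left)
  next
    case (2 t)
    then obtain s where s: "r = [:-t, 1:] * s" by (metis poly_eq_0_iff_dvd dvdE)
    then have s0: "s \<noteq> 0" using less.prems by auto
    have "degree r = Suc (degree s)" unfolding s using s0 by (subst degree_mult_eq) auto
    then have "bounded_below (poly_op s A)"
      using less.prems s s0 by (intro less.hyps) auto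
    moreover have "bounded_below (poly_op [:-t, 1:] A)"
      using bounded_below_not_spectrum[of t A] less.prems(2)[of t] 2 by (auto simp: poly_op_pCons)
    ultimately show ?thesis unfolding s poly_op_mult by (intro bounded_below_compose)
  next
    case 3
    then obtain a b s where b: "b \<noteq> 0" and s: "r = [:a\<^sup>2 + b\<^sup>2, - 2 * a, 1:] * s"
      using real_poly_quadratic_factor by blast
    then have s0: "s \<noteq> 0" using less.prems by auto
    have "degree r = Suc (Suc (degree s))" unfolding s using s0 by (subst degree_mult_eq) auto
    then have "bounded_below (poly_op s A)"
      using 3(2) s0 by (intro less.hyps) (simp_all add: s del: mult_pCons_left)
    then show ?thesis unfolding s poly_op_mult
      using bounded_below_quadratic[OF assms(1) b] by (intro bounded_below_compose)
  qed
qed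

text \<open>The number \<open>l\<^sup>2\<close> with \<open>l = norm B\<close> is an approximate
  eigenvalue of \<open>B o\<^sub>L B\<close>: expanding the square bounds the squared length of
  \<open>(l\<^sup>2 - B\<^sup>2) x\<close> by \<open>l\<^sup>2 * (l\<^sup>2 * (norm x)\<^sup>2 -
  (norm (B x))\<^sup>2)\<close>. A lower bound \<open>c\<close> would improve the operator norm to
  \<open>sqrt (l\<^sup>2 - c\<^sup>2 / l\<^sup>2)\<close>.\<close>

lemma not_bounded_below_norm:
  fixes B :: "('h::chilbert_space) op" and x0 :: 'h
  assumes "hermitian B" and "x0 \<noteq> 0"
  shows "\<not> bounded_below ((norm B)\<^sup>2 *\<^sub>R id_blinfun - (B o\<^sub>L B))"
proof
  define l where "l = norm B"
  assume "bounded_below ((norm B)\<^sup>2 *\<^sub>R id_blinfun - (B o\<^sub>L B))"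
  then obtain c where c: "c > 0"
    "\<And>x. c * norm x \<le> norm (blinfun_apply (l\<^sup>2 *\<^sub>R id_blinfun - (B o\<^sub>L B)) x)"
    unfolding bounded_below_def l_def by blast
  have l0: "l \<ge> 0" by (simp add: l_def)
  have *: "c\<^sup>2 * (norm x)\<^sup>2 \<le> l\<^sup>2 * (l\<^sup>2 * (norm x)\<^sup>2 - (norm (blinfun_apply B x))\<^sup>2)" for x
  proof -
    have "c\<^sup>2 * (norm x)\<^sup>2 = (c * norm x)\<^sup>2" by (simp add: power_mult_distrib)
    also have "\<dots> \<le> (norm (blinfun_apply (l\<^sup>2 *\<^sub>R id_blinfun - (B o\<^sub>L B)) x))\<^sup>2"
      using c by (intro power_mono) auto
    also have "\<dots> = (l\<^sup>2 * norm x)\<^sup>2 - 2 * (l\<^sup>2 * (norm (blinfun_apply B x))\<^sup>2) + (norm (blinfun_apply B (blinfun_apply B x)))\<^sup>2"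
      by (simp add: blinfun.diff_left blinfun.scaleR_left norm_diff_sq cinner_simps
          norm_sq_hermitian[OF assms(1), of x])
    also have "(norm (blinfun_apply B (blinfun_apply B x)))\<^sup>2 \<le> (l * norm (blinfun_apply B x))\<^sup>2"
      unfolding l_def by (intro power_mono norm_blinfun) simp
    finally show ?thesis by (simp add: power_mult_distrib power2_eq_square algebra_simps)
  qed
  \<comment> \<open>For \<open>l = 0\<close> the right side of \<open>*\<close> is 0, while
    \<open>x0\<close> makes the left side positive.\<close>
  have "l \<noteq> 0" using *[of x0] c(1) assms(2) by (auto simp: mult_le_0_iff)
  then have l: "l > 0" using l0 by simp
  define k where "k = l\<^sup>2 - c\<^sup>2 / l\<^sup>2"
  have k: "(norm (blinfun_apply B x))\<^sup>2 \<le> k * (norm x)\<^sup>2" for x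
    using *[of x] l by (simp add: k_def field_simps)
  have "0 \<le> k * (norm x0)\<^sup>2" by (rule order.trans[OF _ k[of x0]]) simp
  then have k0: "0 \<le> k" using assms(2) by (simp add: zero_le_mult_iff)
  have "norm (blinfun_apply B x) \<le> sqrt k * norm x" for x
    using real_sqrt_le_mono[OF k[of x]] by (simp add: real_sqrt_mult)
  then have "l \<le> sqrt k" unfolding l_def by (intro norm_blinfun_bound) (auto simp: k0)
  then have "l\<^sup>2 \<le> k" using l0 k0 by (metis real_sqrt_le_iff real_sqrt_pow2 real_sqrt_abs abs_of_nonneg)
  then show False using c(1) l by (simp add: k_def divide_le_0_iff)
qed

text \<open>With an empty spectrum the polynomial \<open>(norm A)\<^sup>2 - t\<^sup>2\<close> would
  have no zero in it, so its value at \<open>A\<close> would be bounded below.\<close>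

lemma real_spectrum_nonempty:
  fixes A :: "('h::chilbert_space) op" and x0 :: 'h
  assumes "hermitian A" and "x0 \<noteq> 0"
  shows "real_spectrum A \<noteq> {}"
proof
  assume e: "real_spectrum A = {}"
  have "bounded_below (poly_op [:(norm A)\<^sup>2, 0, -1:] A)"
    by (rule bounded_below_poly_op[OF assms(1)]) (auto simp: e)
  then show False
    using not_bounded_below_norm[OF assms] by (simp add: poly_op_pCons blinfun_compose_simps)
qed

text \<open>If \<open>l = \<parallel>q(A)\<parallel>\<close> exceeded the supremum of \<open>\<bar>q\<bar>\<close> on the spectrum, the polynomials
  \<open>l \<plusminus> q\<close> would have no zeros there, so \<open>l\<^sup>2 - q(A)\<^sup>2\<close> would be bounded below.\<close>

lemma norm_poly_op_le:
  assumes "hermitian A" and "0 \<le> c" and c: "\<And>t. t \<in> real_spectrum A \<Longrightarrow> \<bar>poly q t\<bar> \<le> c"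
  shows "norm (poly_op q A) \<le> c"
proof (rule ccontr)
  define l where "l = norm (poly_op q A)"
  assume "\<not> norm (poly_op q A) \<le> c"
  then have lc: "l > c" by (simp add: l_def)
  then have "poly_op q A \<noteq> 0" using assms(2) by (auto simp: l_def)
  then obtain x0 :: 'a where "blinfun_apply (poly_op q A) x0 \<noteq> 0"
    by (metis blinfun_eqI zero_blinfun.rep_eq)
  then have x0: "x0 \<noteq> 0" by (metis blinfun.zero_right)
  \<comment> \<open>\<open>bounded_below_poly_op\<close> asks for nonzero polynomials; their values
    at one spectral point certify this.\<close>
  obtain t0 where t0: "t0 \<in> real_spectrum A" using real_spectrum_nonempty[OF assms(1) x0] by blast
  have nz: "poly ([:l:] - q) t \<noteq> 0" "poly ([:l:] + q) t \<noteq> 0" if "t \<in> real_spectrum A" for t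
    using c[OF that] lc by auto
  have "bounded_below (poly_op ([:l:] - q) A)" "bounded_below (poly_op ([:l:] + q) A)"
    using nz[OF t0] by (intro bounded_below_poly_op[OF assms(1)] nz; force)+
  then have "bounded_below (poly_op ([:l:] - q) A o\<^sub>L poly_op ([:l:] + q) A)"
    by (rule bounded_below_compose)
  also have "poly_op ([:l:] - q) A o\<^sub>L poly_op ([:l:] + q) A
      = l\<^sup>2 *\<^sub>R id_blinfun - (poly_op q A o\<^sub>L poly_op q A)"
    by (simp add: poly_op_diff poly_op_add blinfun_compose_simps power2_eq_square algebra_simps)
  finally show False
    using not_bounded_below_norm[OF hermitian_poly_op[OF assms(1)] x0, of q] by (simp add: l_def)
qed

section \<open>Continuous functional calculus and absolute values\<close>

lemma weierstrass_sequence: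
  fixes f :: "real \<Rightarrow> real"
  assumes "compact S" and "continuous_on S f"
  obtains g :: "nat \<Rightarrow> real poly" where "uniform_limit S (\<lambda>n. poly (g n)) f sequentially"
proof -
  have "\<exists>q. \<forall>t\<in>S. \<bar>f t - poly q t\<bar> < inverse (Suc n)" for n
  proof -
    obtain h where h: "real_polynomial_function h" "\<And>t. t \<in> S \<Longrightarrow> \<bar>f t - h t\<bar> < inverse (Suc n)"
      using Stone_Weierstrass_real_polynomial_function[OF assms, of "inverse (Suc n)"] by auto
    obtain a N where a: "h = (\<lambda>x. \<Sum>i\<le>N. a i * x ^ i)"
      using h(1) unfolding real_polynomial_function_iff_sum by blast
    have "poly (\<Sum>i\<le>N. monom (a i) i) t = h t" for t by (simp add: a poly_sum poly_monom)
    then show ?thesis using h(2) by metis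
  qed
  then obtain g where g: "\<And>n t. t \<in> S \<Longrightarrow> \<bar>f t - poly (g n) t\<bar> < inverse (Suc n)" by metis
  have "uniform_limit S (\<lambda>n. poly (g n)) f sequentially"
  proof (rule uniform_limitI)
    fix e :: real assume "e > 0"
    then have "\<forall>\<^sub>F n in sequentially. inverse (real (Suc n)) < e"
      using order_tendstoD(2)[OF LIMSEQ_inverse_real_of_nat] by blast
    then show "\<forall>\<^sub>F n in sequentially. \<forall>t\<in>S. dist (poly (g n) t) (f t) < e"
    proof eventually_elim
      case (elim n)
      then show ?case using g[of _ n] by (metis dist_real_def dist_commute less_trans)
    qed
  qed
  then show ?thesis using that by blast
qed

lemma poly_op_compose_square: "poly_op q (A o\<^sub>L A) = poly_op (pcompose q [:0, 0, 1:]) A"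
  by (simp add: poly_op_pcompose)

text \<open>Read as a polynomial in \<open>A\<close>, the operator is controlled by the spectrum of
  \<open>A\<close>, whose points have squares in \<open>{0..1}\<close>; the spectrum of
  \<open>A o\<^sub>L A\<close> never has to be computed.\<close>

lemma norm_poly_op_square_le:
  assumes "hermitian A" "norm A \<le> 1" "0 \<le> c" and "\<And>t. t \<in> {0..1} \<Longrightarrow> \<bar>poly q t\<bar> \<le> c"
  shows "norm (poly_op q (A o\<^sub>L A)) \<le> c"
  unfolding poly_op_compose_square
proof (rule norm_poly_op_le[OF assms(1,3)])
  fix t assume "t \<in> real_spectrum A"
  then have "\<bar>t\<bar> \<le> 1" using real_spectrum_bound[of A t] assms(1,2) hermitian_bounded_ops by fastforce
  then have "t * t \<in> {0..1}" by (simp add: abs_square_le_1[unfolded power2_eq_square])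
  then show "\<bar>poly (pcompose q [:0, 0, 1:]) t\<bar> \<le> c" using assms(4) by (simp add: poly_pcompose)
qed

text \<open>If \<open>0 \<le> q \<le> c\<close> on the interval, the centred polynomial
  \<open>q - c/2\<close> has norm at most \<open>c/2\<close> at the operator, and adding
  \<open>c/2\<close> back gives a positive operator.\<close>

lemma positive_poly_op_square:
  assumes "hermitian A" "norm A \<le> 1" and q: "\<And>t. t \<in> {0..1} \<Longrightarrow> 0 \<le> poly q t"
  shows "positive_op (poly_op q (A o\<^sub>L A))"
proof -
  obtain c where c: "\<And>t. t \<in> {0..1} \<Longrightarrow> poly q t \<le> c"
  proof -
    have "continuous_on {0..1} (poly q)" by (intro continuous_intros)
    then show ?thesis
      using continuous_attains_sup[of "{0..1::real}" "poly q"] that by fastforce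
  qed
  have c0: "0 \<le> c" using q[of 0] c[of 0] by simp
  have herm: "hermitian (poly_op q (A o\<^sub>L A))"
    by (intro hermitian_poly_op hermitian_comp assms refl)
  have "norm (poly_op (q - [:c/2:]) (A o\<^sub>L A)) \<le> c / 2"
  proof (rule norm_poly_op_square_le[OF assms(1,2)])
    show "\<bar>poly (q - [:c/2:]) t\<bar> \<le> c / 2" if "t \<in> {0..1}" for t
      using q[OF that] c[OF that] unfolding poly_diff by (simp add: abs_le_iff field_simps)
  qed (use c0 in simp)
  then have "positive_op ((c/2) *\<^sub>R id_blinfun + (poly_op q (A o\<^sub>L A) - (c/2) *\<^sub>R id_blinfun))"
    by (intro positive_op_shift hermitian_diff herm hermitian_scaleR hermitian_id)
       (simp add: poly_op_diff)
  then show ?thesis by simp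
qed

lemma poly_op_square_convergent:
  assumes "hermitian A" "norm A \<le> 1" and "uniform_limit {0..1} (\<lambda>n. poly (g n)) f sequentially"
  obtains C where "(\<lambda>n. poly_op (g n) (A o\<^sub>L A)) \<longlonglongrightarrow> C"
proof -
  have "Cauchy (\<lambda>n. poly_op (g n) (A o\<^sub>L A))"
  proof (rule metric_CauchyI)
    fix e :: real assume e: "e > 0"
    then have "e / 4 > 0" by simp
    from uniform_limitD[OF assms(3) this]
    obtain N where N: "\<forall>n\<ge>N. \<forall>t\<in>{0..1}. dist (poly (g n) t) (f t) < e / 4"
      unfolding eventually_sequentially by blast
    have "dist (poly_op (g m) (A o\<^sub>L A)) (poly_op (g n) (A o\<^sub>L A)) < e" if mn: "m \<ge> N" "n \<ge> N" for m n
    proof -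
      have "norm (poly_op (g m - g n) (A o\<^sub>L A)) \<le> e / 2"
      proof (rule norm_poly_op_square_le[OF assms(1,2)])
        show "\<bar>poly (g m - g n) t\<bar> \<le> e / 2" if "t \<in> {0..1}" for t
        proof -
          have "\<bar>poly (g m) t - f t\<bar> < e / 4" "\<bar>poly (g n) t - f t\<bar> < e / 4"
            using N mn that unfolding dist_real_def by blast+
          then show ?thesis unfolding poly_diff by linarith
        qed
      qed (use e in simp)
      then show ?thesis using e by (simp add: dist_norm poly_op_diff)
    qed
    then show "\<exists>M. \<forall>m\<ge>M. \<forall>n\<ge>M. dist (poly_op (g m) (A o\<^sub>L A)) (poly_op (g n) (A o\<^sub>L A)) < e" by blast
  qed
  then show ?thesis using that Cauchy_convergent_iff convergent_def by blast
qed

text \<open>The approximants themselves may be slightly negative. After adding \<open>e\<close> they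
  are eventually nonnegative on the interval, and \<open>e\<close> is removed again in the quadratic
  form.\<close>

lemma poly_op_square_limit_positive:
  assumes "hermitian A" "norm A \<le> 1" and lim: "uniform_limit {0..1} (\<lambda>n. poly (g n)) f sequentially"
    and C: "(\<lambda>n. poly_op (g n) (A o\<^sub>L A)) \<longlonglongrightarrow> C" and f: "\<And>t. t \<in> {0..1} \<Longrightarrow> 0 \<le> f t"
  shows "positive_op C"
proof -
  have "hermitian C"
    by (rule hermitian_limit[OF _ C]) (intro hermitian_poly_op hermitian_comp assms refl)
  moreover have "0 \<le> Re (cinner x (blinfun_apply C x))" for x
  proof -
    have "- e * (norm x)\<^sup>2 \<le> Re (cinner x (blinfun_apply C x))" if e: "e > 0" for e
    proof (rule tendsto_lowerbound)
      show "(\<lambda>n. Re (cinner x (blinfun_apply (poly_op (g n) (A o\<^sub>L A)) x))) \<longlonglongrightarrow> Re (cinner x (blinfun_apply C x))"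
        by (rule tendsto_cinner_right[OF blinfun.tendsto[OF C tendsto_const]])
      show "\<forall>\<^sub>F n in sequentially. - e * (norm x)\<^sup>2 \<le> Re (cinner x (blinfun_apply (poly_op (g n) (A o\<^sub>L A)) x))"
        using uniform_limitD[OF lim e]
      proof eventually_elim
        case (elim n)
        have "positive_op (poly_op (g n + [:e:]) (A o\<^sub>L A))"
        proof (rule positive_poly_op_square[OF assms(1,2)])
          show "0 \<le> poly (g n + [:e:]) t" if "t \<in> {0..1}" for t
            using bspec[OF elim that] f[OF that] by (simp add: dist_real_def)
        qed
        then have "0 \<le> Re (cinner x (blinfun_apply (poly_op (g n + [:e:]) (A o\<^sub>L A)) x))"
          by (simp add: positive_op_iff_hermitian)
        then show ?case
          by (simp add: poly_op_add blinfun.add_left blinfun.scaleR_left cinner_simps Re_cinner_self)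
      qed
    qed simp
    then have ineq: "0 \<le> Re (cinner x (blinfun_apply C x)) + e * (norm x)\<^sup>2" if "e > 0" for e
      using that by force
    show ?thesis
    proof (rule field_le_epsilon)
      fix d :: real assume d: "d > 0"
      have "d / ((norm x)\<^sup>2 + 1) * (norm x)\<^sup>2 \<le> d" 
        using d by (simp add: pos_divide_le_eq add_nonneg_pos distrib_left)
      then show "0 \<le> Re (cinner x (blinfun_apply C x)) + d"
        using ineq[of "d / ((norm x)\<^sup>2 + 1)"] d by (simp add: add_nonneg_pos)
    qed
  qed
  ultimately show ?thesis by (simp add: positive_op_iff_hermitian)
qed

section \<open>Comparing \<open>cfc\<close> with polynomials in the square\<close>

lemma real_spectrum_unit:
  assumes "positive_op B" "norm B \<le> 1" "t \<in> real_spectrum B"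
  shows "0 \<le> t" "t \<le> 1"
  using real_spectrum_positive[OF assms(1,3)] real_spectrum_bound[of B t] assms
  by (auto simp: positive_op_def)

text \<open>\<open>cfc\<close> quantifies over every \<open>q\<close> converging on the spectrum of
  \<open>B\<close>, whereas \<open>g\<close> approximates on all of \<open>{0..1}\<close> in the
  variable \<open>s = t\<^sup>2\<close>. Both are close to \<open>f t\<close> on the spectrum, so
  the two operator sequences differ by a null sequence.\<close>

lemma poly_op_square_tendsto_iff:
  fixes q g :: "nat \<Rightarrow> real poly"
  assumes B: "positive_op B" "norm B \<le> 1"
    and g: "uniform_limit {0..1} (\<lambda>n. poly (g n)) (\<lambda>s. f (sqrt s)) sequentially"
    and q: "uniform_limit (real_spectrum B) (\<lambda>n. poly (q n)) f sequentially"
  shows "(\<lambda>n. poly_op (q n) B) \<longlonglongrightarrow> C \<longleftrightarrow> (\<lambda>n. poly_op (g n) (B o\<^sub>L B)) \<longlonglongrightarrow> C"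
proof -
  have "(\<lambda>n. poly_op (q n) B - poly_op (g n) (B o\<^sub>L B)) \<longlonglongrightarrow> 0"
  proof (rule LIMSEQ_I)
    fix e :: real assume e: "e > 0"
    then have e4: "e / 4 > 0" by simp
    have "\<forall>\<^sub>F n in sequentially. norm (poly_op (q n) B - poly_op (g n) (B o\<^sub>L B) - 0) < e"
      using uniform_limitD[OF g e4] uniform_limitD[OF q e4]
    proof eventually_elim
      case (elim n)
      have "norm (poly_op (q n - pcompose (g n) [:0, 0, 1:]) B) \<le> e / 2"
      proof (rule norm_poly_op_le)
        show "hermitian B" using B by (simp add: positive_op_iff_hermitian)
        fix t assume t: "t \<in> real_spectrum B"
        then have t01: "0 \<le> t" "t \<le> 1" using real_spectrum_unit[OF B] by auto
        then have "t * t \<in> {0..1}" by (simp add: mult_le_one)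
        then have "\<bar>poly (g n) (t * t) - f t\<bar> < e / 4"
          using bspec[OF elim(1), of "t * t"] t01 by (simp add: dist_real_def)
        moreover have "\<bar>poly (q n) t - f t\<bar> < e / 4"
          using elim(2) t by (simp add: dist_real_def)
        moreover have "poly (q n - pcompose (g n) [:0, 0, 1:]) t = poly (q n) t - poly (g n) (t * t)"
          by (simp add: poly_pcompose)
        ultimately show "\<bar>poly (q n - pcompose (g n) [:0, 0, 1:]) t\<bar> \<le> e / 2"
          by linarith
      qed (use e in simp)
      then show ?case using e by (simp add: poly_op_diff poly_op_compose_square)
    qed
    then show "\<exists>N. \<forall>n\<ge>N. norm (poly_op (q n) B - poly_op (g n) (B o\<^sub>L B) - 0) < e"
      by (simp add: eventually_sequentially)
  qed
  then show ?thesis by (rule Lim_transform_eq)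
qed

text \<open>Uniqueness in the definite description needs at least one admissible sequence, since
  otherwise its condition is vacuous; the polynomials \<open>g n\<close> in \<open>t\<^sup>2\<close>
  form one.\<close>

lemma cfc_eqI:
  assumes B: "positive_op B" "norm B \<le> 1"
    and g: "uniform_limit {0..1} (\<lambda>n. poly (g n)) (\<lambda>s. f (sqrt s)) sequentially"
    and C: "(\<lambda>n. poly_op (g n) (B o\<^sub>L B)) \<longlonglongrightarrow> C"
  shows "cfc f B = C"
proof -
  have gX: "uniform_limit (real_spectrum B) (\<lambda>n. poly (pcompose (g n) [:0, 0, 1:])) f sequentially"
  proof (rule uniform_limitI)
    fix e :: real assume "e > 0"
    from uniform_limitD[OF g this]
    show "\<forall>\<^sub>F n in sequentially. \<forall>t\<in>real_spectrum B. dist (poly (pcompose (g n) [:0, 0, 1:]) t) (f t) < e"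
    proof eventually_elim
      case (elim n)
      show ?case
      proof
        fix t assume "t \<in> real_spectrum B"
        then have t01: "0 \<le> t" "t \<le> 1" using real_spectrum_unit[OF B] by auto
        then have "t * t \<in> {0..1}" by (simp add: mult_le_one)
        then show "dist (poly (pcompose (g n) [:0, 0, 1:]) t) (f t) < e"
          using bspec[OF elim, of "t * t"] t01 by (simp add: poly_pcompose)
      qed
    qed
  qed
  show ?thesis
    unfolding cfc_def real_spectrum_def[symmetric]
  proof (rule the_equality)
    show "\<forall>q. uniform_limit (real_spectrum B) (\<lambda>n. poly (q n)) f sequentially \<longrightarrow>
        (\<lambda>n. poly_op (q n) B) \<longlonglongrightarrow> C"
      using poly_op_square_tendsto_iff[OF B g] C by blast
    fix D assume "\<forall>q. uniform_limit (real_spectrum B) (\<lambda>n. poly (q n)) f sequentially \<longrightarrow>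
        (\<lambda>n. poly_op (q n) B) \<longlonglongrightarrow> D"
    then have "(\<lambda>n. poly_op (g n) (B o\<^sub>L B)) \<longlonglongrightarrow> D"
      using gX by (simp add: poly_op_compose_square)
    then show "D = C" using C LIMSEQ_unique by blast
  qed
qed

text \<open>Justifies the definite description in \<open>abs_op\<close>. The root is a limit of
  polynomials approximating \<open>sqrt\<close>; a competitor \<open>B\<close> has the same square,
  hence also norm at most 1, and is forced to be the same limit.\<close>

lemma positive_sqrt_unique_exists:
  assumes A: "hermitian A" "norm A \<le> 1"
  shows "\<exists>!B. positive_op B \<and> B o\<^sub>L B = A o\<^sub>L A"
proof -
  obtain g where g: "uniform_limit {0..1} (\<lambda>n. poly (g n)) sqrt sequentially"
    by (rule weierstrass_sequence[of "{0..1}" sqrt]) (auto intro!: continuous_intros)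
  obtain S where S: "(\<lambda>n. poly_op (g n) (A o\<^sub>L A)) \<longlonglongrightarrow> S"
    using poly_op_square_convergent[OF A g] .
  have pos: "positive_op S" by (rule poly_op_square_limit_positive[OF A g S]) simp
  have lim0: "(\<lambda>n. poly_op (g n * g n - [:0, 1:]) (A o\<^sub>L A)) \<longlonglongrightarrow> 0"
  proof (rule LIMSEQ_I)
    fix e :: real assume e: "e > 0"
    \<comment> \<open>An error \<open>a\<close> in approximating \<open>sqrt t\<close> changes the
      square by \<open>a * (2 * sqrt t + a)\<close>, at most \<open>3 * d\<close> in size once
      \<open>d \<le> 1\<close>; the factor 1/4 leaves \<open>3 * d < e\<close>.\<close>
    define d where "d = min 1 (e / 4)"
    have d: "d > 0" "d \<le> 1" "3 * d < e" using e by (auto simp: d_def)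
    have "\<forall>\<^sub>F n in sequentially. norm (poly_op (g n * g n - [:0, 1:]) (A o\<^sub>L A) - 0) < e"
      using uniform_limitD[OF g d(1)]
    proof eventually_elim
      case (elim n)
      have "norm (poly_op (g n * g n - [:0, 1:]) (A o\<^sub>L A)) \<le> 3 * d"
      proof (rule norm_poly_op_square_le[OF A])
        fix t :: real assume t: "t \<in> {0..1}"
        define a where "a = poly (g n) t - sqrt t"
        have a: "\<bar>a\<bar> \<le> d" using elim t by (auto simp: a_def dist_real_def intro: less_imp_le)
        have "poly (g n * g n - [:0, 1:]) t = (sqrt t + a) * (sqrt t + a) - sqrt t * sqrt t"
          using t by (simp add: a_def)
        also have "\<dots> = a * (2 * sqrt t + a)" by (simp add: algebra_simps)
        also have "\<bar>\<dots>\<bar> \<le> d * 3"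
          unfolding abs_mult
        proof (rule mult_mono)
          have "0 \<le> sqrt t" "sqrt t \<le> 1" using t by auto
          then show "\<bar>2 * sqrt t + a\<bar> \<le> 3" using a d(2) by linarith
        qed (use a d in auto)
        finally show "\<bar>poly (g n * g n - [:0, 1:]) t\<bar> \<le> 3 * d" by simp
      qed (use d in simp)
      then show ?case using d by simp
    qed
    then show "\<exists>N. \<forall>n\<ge>N. norm (poly_op (g n * g n - [:0, 1:]) (A o\<^sub>L A) - 0) < e"
      by (simp add: eventually_sequentially)
  qed
  have "(\<lambda>n. poly_op (g n * g n - [:0, 1:]) (A o\<^sub>L A)) \<longlonglongrightarrow> (S o\<^sub>L S) - (A o\<^sub>L A)"
    unfolding poly_op_diff poly_op_mult poly_op_X
    by (intro tendsto_diff tendsto_const bounded_bilinear.tendsto[OF bounded_bilinear_blinfun_compose] S)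
  from LIMSEQ_unique[OF this lim0] have SS: "S o\<^sub>L S = A o\<^sub>L A" by simp
  show ?thesis
  proof (rule ex1I[of _ S])
    show "positive_op S \<and> S o\<^sub>L S = A o\<^sub>L A" using pos SS by simp
    fix B assume B: "positive_op B \<and> B o\<^sub>L B = A o\<^sub>L A"
    then have hB: "hermitian B" by (simp add: positive_op_iff_hermitian)
    have "norm (blinfun_apply B x) \<le> 1 * norm x" for x
    proof -
      have "(norm (blinfun_apply B x))\<^sup>2 = (norm (blinfun_apply A x))\<^sup>2"
        using norm_sq_hermitian[OF hB] norm_sq_hermitian[OF A(1)] B by simp
      then have "norm (blinfun_apply B x) = norm (blinfun_apply A x)" by simp
      also have "\<dots> \<le> norm A * norm x" by (rule norm_blinfun)
      also have "\<dots> \<le> 1 * norm x" using A by (intro mult_right_mono) auto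
      finally show ?thesis .
    qed
    then have nB: "norm B \<le> 1" by (intro norm_blinfun_bound) auto
    \<comment> \<open>The constant sequence \<open>[:0, 1:]\<close> approximates
      \<open>f t = t\<close>, and \<open>f (sqrt s) = sqrt s\<close> is what \<open>g\<close>
      approximates; \<open>B\<close> thus shares the limit \<open>S\<close>.\<close>
    have "(\<lambda>n::nat. poly_op [:0, 1:] B) \<longlonglongrightarrow> S"
      by (subst poly_op_square_tendsto_iff[where f = "\<lambda>t. t" and g = g])
         (use B nB g S in \<open>auto intro!: uniform_limitI\<close>)
    then show "B = S" by (simp add: LIMSEQ_const_iff)
  qed
qed

lemma
  assumes A: "hermitian A" "norm A \<le> 1"
  shows positive_abs_op: "positive_op (abs_op A)"
    and abs_op_square: "abs_op A o\<^sub>L abs_op A = A o\<^sub>L A"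
  using theI'[OF positive_sqrt_unique_exists[OF A]]
  unfolding abs_op_def hermitian_adj[OF A(1)] by auto

lemma norm_abs_op_le:
  assumes A: "hermitian A" "norm A \<le> 1"
  shows "norm (abs_op A) \<le> 1"
proof (rule norm_blinfun_bound)
  fix x
  have "(norm (blinfun_apply (abs_op A) x))\<^sup>2 = (norm (blinfun_apply A x))\<^sup>2"
    using norm_sq_hermitian[of "abs_op A" x] norm_sq_hermitian[OF A(1), of x] positive_abs_op[OF A]
    by (simp add: abs_op_square[OF A] positive_op_iff_hermitian)
  then have "norm (blinfun_apply (abs_op A) x) = norm (blinfun_apply A x)" by simp
  also have "\<dots> \<le> norm A * norm x" by (rule norm_blinfun)
  also have "\<dots> \<le> 1 * norm x" using A by (intro mult_right_mono) auto
  finally show "norm (blinfun_apply (abs_op A) x) \<le> 1 * norm x" .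
qed simp

text \<open>Since \<open>t powr p = (t\<^sup>2) powr (p/2)\<close> for nonnegative \<open>t\<close>,
  the p-norm is from here on computed from polynomials in \<open>A o\<^sub>L A\<close>.\<close>

lemma cfc_powr_abs_op_tendsto:
  assumes A: "hermitian A" "norm A \<le> 1"
    and g: "uniform_limit {0..1} (\<lambda>n. poly (g n)) (\<lambda>s. s powr (p/2)) sequentially"
  shows "(\<lambda>n. poly_op (g n) (A o\<^sub>L A)) \<longlonglongrightarrow> cfc (\<lambda>t. t powr p) (abs_op A)"
proof -
  obtain C where C: "(\<lambda>n. poly_op (g n) (A o\<^sub>L A)) \<longlonglongrightarrow> C"
    using poly_op_square_convergent[OF A g] .
  have g': "uniform_limit {0..1} (\<lambda>n. poly (g n)) (\<lambda>s. sqrt s powr p) sequentially"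
  proof (rule uniform_limit_cong'[THEN iffD1, OF refl _ g])
    show "s powr (p/2) = sqrt s powr p" if "s \<in> {0..1}" for s
    proof -
      have "sqrt s = s powr (1/2)" using that by (subst powr_half_sqrt) auto
      then show ?thesis by (simp only: powr_powr) simp
    qed
  qed
  have "cfc (\<lambda>t. t powr p) (abs_op A) = C"
    by (rule cfc_eqI[OF positive_abs_op[OF A] norm_abs_op_le[OF A] g'])
       (simp add: abs_op_square[OF A] C)
  then show ?thesis using C by simp
qed

section \<open>Tracial states\<close>

lemma commutant_closed:
  assumes "A \<in> commutant S" "B \<in> commutant S"
  shows commutant_add: "A + B \<in> commutant S"
    and commutant_diff: "A - B \<in> commutant S"
    and commutant_comp: "A o\<^sub>L B \<in> commutant S"
    and commutant_scaleR: "r *\<^sub>R A \<in> commutant S"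
proof -
  show "A o\<^sub>L B \<in> commutant S"
    using assms unfolding commutant_def
    by (auto simp: bounded_ops_closed) (metis blinfun_compose_assoc)
qed (use assms in \<open>auto simp: commutant_def bounded_ops_closed blinfun_compose_simps\<close>)

lemma commutant_id: "id_blinfun \<in> commutant S"
  by (simp add: commutant_def bounded_ops_closed)

text \<open>Applied to the bicommutant, this keeps the limits of the functional calculus inside the
  algebra.\<close>

lemma commutant_limit:
  assumes "\<And>n. A n \<in> commutant S" and lim: "A \<longlonglongrightarrow> B"
  shows "B \<in> commutant S"
proof -
  have "C o\<^sub>L B = B o\<^sub>L C" if C: "C \<in> S" for C
  proof (rule LIMSEQ_unique)
    show "(\<lambda>n. C o\<^sub>L A n) \<longlonglongrightarrow> (C o\<^sub>L B)"
      by (intro bounded_bilinear.tendsto[OF bounded_bilinear_blinfun_compose] tendsto_const lim)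
    have "(\<lambda>n. A n o\<^sub>L C) \<longlonglongrightarrow> (B o\<^sub>L C)"
      by (intro bounded_bilinear.tendsto[OF bounded_bilinear_blinfun_compose] tendsto_const lim)
    moreover have "A n o\<^sub>L C = C o\<^sub>L A n" for n using assms(1)[of n] C by (simp add: commutant_def)
    ultimately show "(\<lambda>n. C o\<^sub>L A n) \<longlonglongrightarrow> (B o\<^sub>L C)" by simp
  qed
  moreover have "B \<in> bounded_ops"
    by (rule bounded_ops_limit[OF _ lim]) (use assms(1) in \<open>simp add: commutant_def\<close>)
  ultimately show ?thesis by (simp add: commutant_def)
qed

locale tracial_algebra =
  fixes M :: "('h::chilbert_space) op set" and \<tau> :: "'h op \<Rightarrow> complex"
  assumes vna: "von_neumann_algebra M" and state: "tracial_state M \<tau>"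
begin

lemma bicommutant: "M = commutant (commutant M)"
  using vna by (simp add: von_neumann_algebra_def)

lemma
  assumes "A \<in> M" "B \<in> M"
  shows mem_add: "A + B \<in> M" and mem_diff: "A - B \<in> M" and mem_comp: "A o\<^sub>L B \<in> M"
  using assms commutant_closed[of A "commutant M" B] by (simp_all flip: bicommutant)

lemma mem_scaleR: "A \<in> M \<Longrightarrow> r *\<^sub>R A \<in> M"
  using commutant_scaleR[of A "commutant M" A] by (simp flip: bicommutant)

lemma mem_id: "id_blinfun \<in> M"
  using commutant_id[of "commutant M"] by (simp flip: bicommutant)

lemma mem_limit: "(\<And>n. A n \<in> M) \<Longrightarrow> A \<longlonglongrightarrow> B \<Longrightarrow> B \<in> M"
  using commutant_limit[of A "commutant M" B] by (simp flip: bicommutant)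

lemma mem_poly_op: "A \<in> M \<Longrightarrow> poly_op q A \<in> M"
proof (induction q)
  case 0
  then show ?case using mem_scaleR[of A 0] by simp
next
  case (pCons a q)
  then show ?case unfolding poly_op_pCons by (intro mem_add mem_scaleR mem_comp mem_id) auto
qed

lemma trace_add: "A \<in> M \<Longrightarrow> B \<in> M \<Longrightarrow> \<tau> (A + B) = \<tau> A + \<tau> B"
  using state by (simp add: tracial_state_def)

lemma trace_scaleR: "A \<in> M \<Longrightarrow> \<tau> (r *\<^sub>R A) = of_real r * \<tau> A"
  using state by (simp add: tracial_state_def flip: cscale_op_of_real)

lemma trace_diff: "A \<in> M \<Longrightarrow> B \<in> M \<Longrightarrow> \<tau> (A - B) = \<tau> A - \<tau> B"
  using trace_add[of A "(-1) *\<^sub>R B"] trace_scaleR[of B "-1"] mem_scaleR[of B "-1"] by simp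

lemma trace_id: "\<tau> id_blinfun = 1"
  using state by (simp add: tracial_state_def)

lemma trace_positive: "A \<in> M \<Longrightarrow> positive_op A \<Longrightarrow> \<tau> A \<in> \<real>\<^sub>\<ge>\<^sub>0"
  using state by (simp add: tracial_state_def)

lemma Re_trace_positive: "A \<in> M \<Longrightarrow> positive_op A \<Longrightarrow> 0 \<le> Re (\<tau> A)"
  using trace_positive by (simp add: complex_nonneg_Reals_iff)

text \<open>Both \<open>norm A + A\<close> and \<open>norm A - A\<close> are positive. The bound
  supplies the norm continuity of the trace.\<close>

lemma abs_Re_trace_le:
  assumes "A \<in> M" "hermitian A"
  shows "\<bar>Re (\<tau> A)\<bar> \<le> norm A"
proof -
  have m: "norm A *\<^sub>R id_blinfun \<in> M" "norm A *\<^sub>R id_blinfun + A \<in> M" "norm A *\<^sub>R id_blinfun - A \<in> M"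
    using assms mem_id by (auto intro: mem_add mem_diff mem_scaleR)
  have "positive_op (norm A *\<^sub>R id_blinfun + A)" using assms by (intro positive_op_shift) auto
  moreover have "positive_op (norm A *\<^sub>R id_blinfun + (-1) *\<^sub>R A)"
    using assms by (intro positive_op_shift hermitian_scaleR) auto
  ultimately have "0 \<le> Re (\<tau> (norm A *\<^sub>R id_blinfun + A))" "0 \<le> Re (\<tau> (norm A *\<^sub>R id_blinfun - A))"
    using m by (auto intro: Re_trace_positive)
  then show ?thesis
    using m assms mem_id by (simp add: trace_add trace_diff trace_scaleR trace_id)
qed

lemma Re_trace_tendsto:
  assumes "\<And>n. A n \<in> M" "\<And>n. hermitian (A n)" and lim: "A \<longlonglongrightarrow> B"
  shows "(\<lambda>n. Re (\<tau> (A n))) \<longlonglongrightarrow> Re (\<tau> B)"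
proof -
  have B: "B \<in> M" "hermitian B" using assms mem_limit hermitian_limit by blast+
  have "(\<lambda>n. Re (\<tau> (A n)) - Re (\<tau> B)) \<longlonglongrightarrow> 0"
  proof (rule Lim_null_comparison)
    show "\<forall>\<^sub>F n in sequentially. norm (Re (\<tau> (A n)) - Re (\<tau> B)) \<le> norm (A n - B)"
      using abs_Re_trace_le[of "A n - B" for n] assms B
      by (auto simp: trace_diff mem_diff hermitian_diff)
    show "(\<lambda>n. norm (A n - B)) \<longlonglongrightarrow> 0"
      using lim by (simp add: LIM_zero_iff tendsto_norm_zero_iff)
  qed
  then show ?thesis by (simp add: LIM_zero_iff)
qed

lemma trace_pnorm_eq_limit:
  assumes "A \<in> M" "hermitian A" "norm A \<le> 1"
    and g: "uniform_limit {0..1} (\<lambda>n. poly (g n)) (\<lambda>s. s powr (p/2)) sequentially"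
  obtains L where "0 \<le> L" "trace_pnorm \<tau> p A = L powr (1/p)"
    "(\<lambda>n. Re (\<tau> (poly_op (g n) (A o\<^sub>L A)))) \<longlonglongrightarrow> L"
proof -
  let ?C = "cfc (\<lambda>t. t powr p) (abs_op A)"
  have lim: "(\<lambda>n. poly_op (g n) (A o\<^sub>L A)) \<longlonglongrightarrow> ?C"
    by (rule cfc_powr_abs_op_tendsto[OF assms(2,3) g])
  have mem: "poly_op (g n) (A o\<^sub>L A) \<in> M" for n by (intro mem_poly_op mem_comp assms)
  have "positive_op ?C"
    by (rule poly_op_square_limit_positive[OF assms(2,3) g lim]) simp
  then have "0 \<le> Re (\<tau> ?C)" using mem_limit[OF mem lim] by (rule Re_trace_positive[rotated])
  moreover have "(\<lambda>n. Re (\<tau> (poly_op (g n) (A o\<^sub>L A)))) \<longlonglongrightarrow> Re (\<tau> ?C)"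
    by (rule Re_trace_tendsto[OF mem _ lim]) (intro hermitian_poly_op hermitian_comp assms refl)
  ultimately show ?thesis using that by (simp add: trace_pnorm_def)
qed

end

section \<open>The extremal inequality\<close>

lemma powr_eq_one_over_sqrt2_iff:
  fixes L p :: real
  assumes "0 \<le> L" "0 < p"
  shows "L powr (1/p) = 1 / sqrt 2 \<longleftrightarrow> L = (1/2) powr (p/2)"
proof -
  have e: "1 / sqrt 2 = (1/2) powr (1/2)" by (subst powr_half_sqrt) (auto simp: real_sqrt_divide)
  show ?thesis
  proof
    assume "L powr (1/p) = 1 / sqrt 2"
    then have "(L powr (1/p)) powr p = ((1/2) powr (1/2)) powr p" using e by simp
    then show "L = (1/2) powr (p/2)" using assms unfolding powr_powr by simp
  next
    assume "L = (1/2) powr (p/2)"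
    then show "L powr (1/p) = 1 / sqrt 2" unfolding e using assms by (simp only: powr_powr) simp
  qed
qed

text \<open>The excess of \<open>s\<^sup>q + (1 - s)\<^sup>q\<close> over its midpoint value. For
  \<open>q = p/2\<close>, its trace at \<open>T\<close> is the sum of the p-th powers of the two
  norms minus the value that \<open>1/\<surd>2\<close> prescribes.\<close>

definition defect :: "real \<Rightarrow> real \<Rightarrow> real" where
  "defect q s = s powr q + (1 - s) powr q - 2 * (1/2) powr q"

text \<open>Mean value theorem on either side of 1/2. The point \<open>y\<close> stays positive even
  for \<open>u = 1/2\<close>, although the derivative blows up at 0 when
  \<open>q < 1\<close>.\<close>

lemma defect_mean_value:
  fixes q u :: real
  assumes "0 < u" "u \<le> 1/2" "0 < q"
  obtains x y where "0 < y" "y < 1/2" "1/2 < x"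
    "defect q (1/2 + u) = u * q * (x powr (q - 1) - y powr (q - 1))"
proof -
  have D: "((\<lambda>t. t powr q) has_real_derivative q * t powr (q - 1)) (at t)" if "t > 0" for t :: real
    using that by (auto intro!: derivative_eq_intros simp: powr_diff)
  have diff: "(\<lambda>t. t powr q) differentiable (at t)" if "t > 0" for t :: real
    using D[OF that] real_differentiable_def by blast
  have c: "continuous_on {a..b} (\<lambda>t. t powr q)" if "a \<ge> 0" for a b :: real
    using that assms by (intro continuous_on_powr' continuous_intros) auto
  obtain x where x: "1/2 < x" "x < 1/2 + u" "(1/2 + u) powr q - (1/2) powr q = u * (q * x powr (q - 1))"
  proof -
    have "\<exists>l z. 1/2 < z \<and> z < 1/2 + u \<and> ((\<lambda>t. t powr q) has_real_derivative l) (at z) \<and>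
        (1/2 + u) powr q - (1/2) powr q = (1/2 + u - 1/2) * l"
      by (rule MVT) (use assms c in \<open>auto intro!: diff\<close>)
    then obtain l z where z: "1/2 < z" "z < 1/2 + u" "((\<lambda>t. t powr q) has_real_derivative l) (at z)"
      "(1/2 + u) powr q - (1/2) powr q = (1/2 + u - 1/2) * l" by blast
    have "l = q * z powr (q - 1)" using z(1) by (intro DERIV_unique[OF z(3) D]) simp
    then show ?thesis using z that by simp
  qed
  obtain y where y: "1/2 - u < y" "y < 1/2" "(1/2) powr q - (1/2 - u) powr q = u * (q * y powr (q - 1))"
  proof -
    have "\<exists>l z. 1/2 - u < z \<and> z < 1/2 \<and> ((\<lambda>t. t powr q) has_real_derivative l) (at z) \<and>
        (1/2) powr q - (1/2 - u) powr q = (1/2 - (1/2 - u)) * l"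
      by (rule MVT) (use assms c in \<open>auto intro!: diff\<close>)
    then obtain l z where z: "1/2 - u < z" "z < 1/2" "((\<lambda>t. t powr q) has_real_derivative l) (at z)"
      "(1/2) powr q - (1/2 - u) powr q = (1/2 - (1/2 - u)) * l" by blast
    have "l = q * z powr (q - 1)" using z(1) assms by (intro DERIV_unique[OF z(3) D]) simp
    then show ?thesis using z that by simp
  qed
  have "1 - (1/2 + u) = 1/2 - u" by simp
  then have "defect q (1/2 + u) = u * q * (x powr (q - 1) - y powr (q - 1))"
    using x(3) y(3) unfolding defect_def by (simp only: right_diff_distrib mult.assoc)
  moreover have "0 < y" using y(1) assms(2) by simp
  ultimately show ?thesis using that x(1) y(2) by blast
qed

text \<open>\<open>t powr (q - 1)\<close> is strictly increasing for \<open>q > 1\<close> and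
  strictly decreasing for \<open>q < 1\<close>; the sign of \<open>q - 1\<close> treats minimum and
  maximum together, and the symmetry \<open>s \<mapsto> 1 - s\<close> leaves only
  \<open>s > 1/2\<close>.\<close>

lemma defect_sign:
  assumes "0 < q" "q \<noteq> 1"
  obtains e :: real where "\<And>s. s \<in> {0..1} \<Longrightarrow> s \<noteq> 1/2 \<Longrightarrow> 0 < e * defect q s"
proof -
  define e :: real where "e = sgn (q - 1)"
  have pos: "0 < e * defect q (1/2 + u)" if u: "0 < u" "u \<le> 1/2" for u
  proof -
    obtain x y where xy: "0 < y" "y < 1/2" "1/2 < x"
      and eq: "defect q (1/2 + u) = u * q * (x powr (q - 1) - y powr (q - 1))"
      using defect_mean_value[OF u assms(1)] by blast
    have "0 < e * (x powr (q - 1) - y powr (q - 1))"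
    proof (cases "q > 1")
      case True
      have "y powr (q - 1) < x powr (q - 1)" using xy True by (intro powr_less_mono2) auto
      then show ?thesis using True by (simp add: e_def)
    next
      case False
      then have "x powr (q - 1) < y powr (q - 1)" using xy assms by (intro powr_less_mono2_neg) auto
      then show ?thesis using False assms by (simp add: e_def)
    qed
    then have "0 < (u * q) * (e * (x powr (q - 1) - y powr (q - 1)))" using u assms by simp
    then show ?thesis unfolding eq by (simp add: mult.assoc mult.left_commute)
  qed
  have sym: "defect q (1 - s) = defect q s" for s by (simp add: defect_def)
  have "0 < e * defect q s" if "s \<in> {0..1}" "s \<noteq> 1/2" for s
  proof (cases "s > 1/2")
    case True
    then show ?thesis using pos[of "s - 1/2"] that by simp
  next
    case False
    then show ?thesis using pos[of "1 - s - 1/2"] that sym[of s] by simp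
  qed
  then show ?thesis using that by blast
qed

text \<open>Away from 1/2 the signed defect has a positive minimum \<open>m\<close> by compactness,
  and \<open>C = e / m\<close> beats \<open>(s - 1/2)\<^sup>2 \<le> 1\<close>; near 1/2 the slack
  \<open>d\<close> suffices. \<open>C\<close> carries the sign \<open>e\<close>, so it is negative
  for \<open>q < 1\<close>.\<close>

lemma defect_bound:
  assumes "0 < q" "q \<noteq> 1" "0 < d"
  obtains C :: real where "\<And>s. s \<in> {0..1} \<Longrightarrow> (s - 1/2)\<^sup>2 \<le> d + C * defect q s"
proof -
  obtain e where e: "\<And>s. s \<in> {0..1} \<Longrightarrow> s \<noteq> 1/2 \<Longrightarrow> 0 < e * defect q s"
    using defect_sign[OF assms(1,2)] by blast
  have half: "defect q (1/2) = 0" by (simp add: defect_def)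
  have nonneg: "0 \<le> e * defect q s" if "s \<in> {0..1}" for s
  proof (cases "s = 1/2")
    case True
    then show ?thesis unfolding True half by simp
  qed (use e[OF that] in simp)
  define K where "K = {0..1} \<inter> {s::real. d \<le> (s - 1/2)\<^sup>2}"
  have "closed {s::real. d \<le> (s - 1/2)\<^sup>2}" by (intro closed_Collect_le continuous_intros)
  then have K: "compact K" unfolding K_def by (intro compact_Int_closed) auto
  have "\<exists>m>0. \<forall>s\<in>K. m \<le> e * defect q s"
  proof (cases "K = {}")
    case False
    have "continuous_on K (\<lambda>s. e * defect q s)"
      unfolding defect_def K_def using assms by (intro continuous_on_powr' continuous_intros) auto
    then obtain s0 where s0: "s0 \<in> K" "\<And>s. s \<in> K \<Longrightarrow> e * defect q s0 \<le> e * defect q s"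
      using continuous_attains_inf[OF K False] by blast
    have "0 < e * defect q s0" 
    proof (rule e)
      show "s0 \<noteq> 1/2"
      proof
        assume "s0 = 1/2"
        moreover have "d \<le> (s0 - 1/2)\<^sup>2" using s0(1) by (simp add: K_def)
        ultimately show False using assms(3) by (auto simp only: diff_self zero_power2)
      qed
    qed (use s0(1) in \<open>simp add: K_def\<close>)
    then show ?thesis using s0 by blast
  qed (auto intro: exI[of _ 1])
  then obtain m where m: "m > 0" "\<And>s. s \<in> K \<Longrightarrow> m \<le> e * defect q s" by blast
  have "(s - 1/2)\<^sup>2 \<le> d + e / m * defect q s" if s: "s \<in> {0..1}" for s
  proof (cases "s \<in> K")
    case True
    have "(s - 1/2)\<^sup>2 \<le> 1" using s by (subst abs_square_le_1) auto
    also have "1 \<le> e / m * defect q s" using m True by (simp add: field_simps)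
    finally show ?thesis using assms by simp
  next
    case False
    then have "(s - 1/2)\<^sup>2 \<le> d" using s by (auto simp: K_def)
    moreover have "0 \<le> e / m * defect q s" using nonneg[OF s] m by simp
    ultimately show ?thesis by simp
  qed
  then show ?thesis using that by blast
qed

section \<open>Passing from the scalar inequality to the trace\<close>

lemma powr_approximation:
  assumes "0 < p"
  obtains g :: "nat \<Rightarrow> real poly"
    where "uniform_limit {0..1} (\<lambda>n. poly (g n)) (\<lambda>s. s powr (p/2)) sequentially"
proof (rule weierstrass_sequence)
  show "continuous_on {0..1::real} (\<lambda>s. s powr (p/2))"
    using assms by (intro continuous_on_powr' continuous_intros) auto
qed (auto intro: that)

lemma norm_le_1_of_squares:
  assumes "hermitian X" "hermitian Y" and sum: "(X o\<^sub>L X) + (Y o\<^sub>L Y) = id_blinfun"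
  shows "norm X \<le> 1"
proof (rule norm_blinfun_bound)
  fix x
  have "(norm (blinfun_apply X x))\<^sup>2 + (norm (blinfun_apply Y x))\<^sup>2
      = Re (cinner x (blinfun_apply ((X o\<^sub>L X) + (Y o\<^sub>L Y)) x))"
    unfolding norm_sq_hermitian[OF assms(1)] norm_sq_hermitian[OF assms(2)]
    by (simp only: blinfun.add_left cinner_simps plus_complex.sel)
  also have "\<dots> = (norm x)\<^sup>2" by (simp add: sum Re_cinner_self)
  finally have "(norm (blinfun_apply X x))\<^sup>2 \<le> (norm x)\<^sup>2"
    using zero_le_power2[of "norm (blinfun_apply Y x)"] by linarith
  then show "norm (blinfun_apply X x) \<le> 1 * norm x" by (simp add: power2_le_iff_abs_le)
qed simp

context tracial_algebra
begin

lemma trace_pnorm_of_square_half: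
  assumes "X \<in> M" "hermitian X" "norm X \<le> 1" "X o\<^sub>L X = (1/2) *\<^sub>R id_blinfun" "0 < p"
  shows "trace_pnorm \<tau> p X = 1 / sqrt 2"
proof -
  obtain g where g: "uniform_limit {0..1} (\<lambda>n. poly (g n)) (\<lambda>s. s powr (p/2)) sequentially"
    using powr_approximation[OF assms(5)] by blast
  obtain L where L: "0 \<le> L" "trace_pnorm \<tau> p X = L powr (1/p)"
    "(\<lambda>n. Re (\<tau> (poly_op (g n) (X o\<^sub>L X)))) \<longlonglongrightarrow> L"
    using trace_pnorm_eq_limit[OF assms(1-3) g] by blast
  have const: "poly_op q (c *\<^sub>R id_blinfun) = poly q c *\<^sub>R id_blinfun" for q c
    by (induction q) (simp_all add: poly_op_pCons blinfun_compose_simps scaleR_add_left mult.commute)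
  have "Re (\<tau> (poly_op (g n) (X o\<^sub>L X))) = poly (g n) (1/2)" for n
    using mem_id by (simp add: assms(4) const trace_scaleR trace_id)
  moreover have "(\<lambda>n. poly (g n) (1/2)) \<longlonglongrightarrow> (1/2) powr (p/2)"
    by (rule tendsto_uniform_limitI[OF g]) simp
  ultimately have "L = (1/2) powr (p/2)" using L(3) LIMSEQ_unique by auto
  then show ?thesis using L powr_eq_one_over_sqrt2_iff[OF L(1) assms(5)] by simp
qed

lemma square_half_of_trace_pnorm:
  assumes faithful: "faithful_on M \<tau>" and p: "0 < p" "p \<noteq> 2"
    and X: "X \<in> M" "hermitian X" and Y: "Y \<in> M" "hermitian Y"
    and sum: "(X o\<^sub>L X) + (Y o\<^sub>L Y) = id_blinfun"
    and nX: "trace_pnorm \<tau> p X = 1 / sqrt 2" and nY: "trace_pnorm \<tau> p Y = 1 / sqrt 2"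
  shows "X o\<^sub>L X = (1/2) *\<^sub>R id_blinfun"
proof -
  have X1: "norm X \<le> 1" by (rule norm_le_1_of_squares[OF X(2) Y(2) sum])
  have Y1: "norm Y \<le> 1" by (rule norm_le_1_of_squares[OF Y(2) X(2)]) (use sum in \<open>simp add: add.commute\<close>)
  obtain g where g: "uniform_limit {0..1} (\<lambda>n. poly (g n)) (\<lambda>s. s powr (p/2)) sequentially"
    using powr_approximation[OF p(1)] by blast
  define k where "k = (1/2::real) powr (p/2)"
  define T where "T = X o\<^sub>L X"
  \<comment> \<open>Both norm conditions become statements about polynomials in the single operator
    \<open>T\<close>.\<close>
  have YT: "Y o\<^sub>L Y = poly_op [:1, -1:] T"
    using sum by (simp add: T_def poly_op_pCons blinfun_compose_simps algebra_simps)
  obtain LX where LX: "0 \<le> LX" "trace_pnorm \<tau> p X = LX powr (1/p)"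
    "(\<lambda>n. Re (\<tau> (poly_op (g n) (X o\<^sub>L X)))) \<longlonglongrightarrow> LX"
    using trace_pnorm_eq_limit[OF X X1 g] by blast
  then have limX: "(\<lambda>n. Re (\<tau> (poly_op (g n) T))) \<longlonglongrightarrow> k"
    using nX powr_eq_one_over_sqrt2_iff[OF LX(1) p(1)] by (simp add: T_def k_def)
  obtain LY where LY: "0 \<le> LY" "trace_pnorm \<tau> p Y = LY powr (1/p)"
    "(\<lambda>n. Re (\<tau> (poly_op (g n) (Y o\<^sub>L Y)))) \<longlonglongrightarrow> LY"
    using trace_pnorm_eq_limit[OF Y Y1 g] by blast
  then have limY: "(\<lambda>n. Re (\<tau> (poly_op (pcompose (g n) [:1, -1:]) T))) \<longlonglongrightarrow> k"
    using nY powr_eq_one_over_sqrt2_iff[OF LY(1) p(1)] by (simp add: k_def YT poly_op_pcompose)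
  have TM: "T \<in> M" unfolding T_def by (intro mem_comp X)
  have mem: "poly_op q T \<in> M" for q by (intro mem_poly_op TM)
  have idM: "id_blinfun \<in> M" by (rule mem_id)
  define W where "W = T - (1/2) *\<^sub>R id_blinfun"
  have W: "hermitian W" "W \<in> M"
    unfolding W_def T_def by (intro hermitian_diff hermitian_comp hermitian_scaleR hermitian_id X refl)
      (intro mem_diff mem_comp mem_scaleR X idM)
  have WW: "W o\<^sub>L W = poly_op ([:-1/2, 1:] * [:-1/2, 1:]) T"
    unfolding poly_op_mult by (simp add: W_def poly_op_pCons)
  have small: "Re (\<tau> (W o\<^sub>L W)) \<le> 0 + d" if d: "d > 0" for d
  proof -
    have "p / 2 \<noteq> 1" "0 < p / 2" "0 < d / 2" using p d by auto
    then obtain C where C: "\<And>s. s \<in> {0..1} \<Longrightarrow> (s - 1/2)\<^sup>2 \<le> d / 2 + C * defect (p/2) s"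
      using defect_bound[of "p/2" "d/2"] by blast
    \<comment> \<open>Polynomial stand-in for \<open>defect (p/2)\<close>, eventually within
      \<open>2 * b\<close> of it on the unit interval.\<close>
    define h where "h n = g n + pcompose (g n) [:1, -1:] - [:2 * k:]" for n
    \<comment> \<open>Half of the slack \<open>d\<close> goes to the scalar inequality, the other
      half to the approximation error \<open>\<bar>C\<bar> * (2 * b)\<close>; the added 1 covers
      \<open>C = 0\<close>.\<close>
    define b where "b = d / (4 * (\<bar>C\<bar> + 1))"
    have b: "b > 0" "\<bar>C\<bar> * (2 * b) \<le> d / 2" using d by (auto simp: b_def field_simps)
    have "Re (\<tau> (poly_op (h n) T))
        = Re (\<tau> (poly_op (g n) T)) + Re (\<tau> (poly_op (pcompose (g n) [:1, -1:]) T)) - 2 * k" for n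
      unfolding h_def using mem idM
      by (simp add: poly_op_diff poly_op_add trace_diff trace_add trace_scaleR trace_id mem_add mem_scaleR[OF idM])
    moreover have "(\<lambda>n. Re (\<tau> (poly_op (g n) T)) + Re (\<tau> (poly_op (pcompose (g n) [:1, -1:]) T)) - 2 * k)
        \<longlonglongrightarrow> k + k - 2 * k"
      by (intro tendsto_intros limX limY)
    ultimately have "(\<lambda>n. Re (\<tau> (poly_op (h n) T))) \<longlonglongrightarrow> 0" by simp
    then have lim: "(\<lambda>n. d + C * Re (\<tau> (poly_op (h n) T))) \<longlonglongrightarrow> d + C * 0"
      by (intro tendsto_intros)
    have "Re (\<tau> (W o\<^sub>L W)) \<le> d + C * 0"
    proof (rule tendsto_lowerbound[OF lim])
      show "\<forall>\<^sub>F n in sequentially. Re (\<tau> (W o\<^sub>L W)) \<le> d + C * Re (\<tau> (poly_op (h n) T))"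
        using uniform_limitD[OF g b(1)]
      proof eventually_elim
        case (elim n)
        \<comment> \<open>Its value at \<open>s\<close> is
          \<open>d + C * poly (h n) s - (s - 1/2)\<^sup>2\<close>; nonnegativity on the interval
          makes the scalar inequality an operator inequality.\<close>
        let ?q = "[:d:] + smult C (h n) - [:-1/2, 1:] * [:-1/2, 1:]"
        have "positive_op (poly_op ?q T)"
          unfolding T_def
        proof (rule positive_poly_op_square[OF X(2) X1])
          fix s :: real assume s: "s \<in> {0..1}"
          have "\<bar>poly (g n) s - s powr (p/2)\<bar> < b" "\<bar>poly (g n) (1 - s) - (1 - s) powr (p/2)\<bar> < b"
            using bspec[OF elim, of s] bspec[OF elim, of "1 - s"] s by (auto simp: dist_real_def)
          then have "\<bar>poly (h n) s - defect (p/2) s\<bar> \<le> 2 * b"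
            by (simp add: h_def poly_pcompose defect_def k_def)
          then have "\<bar>C\<bar> * \<bar>poly (h n) s - defect (p/2) s\<bar> \<le> \<bar>C\<bar> * (2 * b)"
            by (intro mult_left_mono) auto
          then have "\<bar>C * poly (h n) s - C * defect (p/2) s\<bar> \<le> d / 2"
            using b(2) by (simp add: abs_mult[symmetric] right_diff_distrib)
          then have "(s - 1/2)\<^sup>2 \<le> d + C * poly (h n) s" using C[OF s] by linarith
          then show "0 \<le> poly ?q s" by (simp add: power2_eq_square algebra_simps)
        qed
        then have "0 \<le> Re (\<tau> (poly_op ?q T))" using mem by (intro Re_trace_positive)
        also have "poly_op ?q T = (d *\<^sub>R id_blinfun + C *\<^sub>R poly_op (h n) T) - (W o\<^sub>L W)"
          unfolding poly_op_diff poly_op_add poly_op_smult WW by simp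
        also have "Re (\<tau> \<dots>) = d + C * Re (\<tau> (poly_op (h n) T)) - Re (\<tau> (W o\<^sub>L W))"
          using mem[of "h n"] idM W mem_comp[OF W(2,2)]
          by (simp add: trace_diff trace_add trace_scaleR trace_id mem_add mem_scaleR)
        finally show ?case by simp
      qed
    qed simp
    then show ?thesis by simp
  qed
  have WWM: "W o\<^sub>L W \<in> M" by (intro mem_comp W)
  have "Re (\<tau> (W o\<^sub>L W)) \<le> 0" using small by (rule field_le_epsilon)
  then have "\<tau> (W o\<^sub>L W) = 0"
    using trace_positive[OF WWM positive_op_square[OF W(1)]]
    by (simp add: complex_nonneg_Reals_iff complex_eq_iff)
  then have "W o\<^sub>L W = 0"
    using faithful WWM positive_op_square[OF W(1)] by (simp add: faithful_on_def)
  then have "W = 0" using W hermitian_square_zero by blast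
  then show ?thesis by (simp add: W_def T_def)
qed

end

section \<open>Pairs of projections\<close>

lemma projection_difference_squares:
  assumes "P o\<^sub>L P = P" "Q o\<^sub>L Q = Q"
  shows "(P - Q) o\<^sub>L (P - Q) = P + Q - (P o\<^sub>L Q) - (Q o\<^sub>L P)"
    and "((P - Q) o\<^sub>L (P - Q)) + ((id_blinfun - P - Q) o\<^sub>L (id_blinfun - P - Q)) = id_blinfun"
  using assms by (simp_all add: blinfun_compose_simps)

text \<open>Since the squared norm of \<open>U z\<close> is the quadratic form of \<open>P\<close>
  at \<open>z\<close>, the vector \<open>x - P x\<close> lies in the kernel of \<open>U\<close>. It
  is then orthogonal to \<open>x\<close>, and also to \<open>P x\<close>, so it vanishes and
  \<open>U\<close> preserves the norm of \<open>x = P x\<close>.\<close>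

lemma partial_isometryI:
  assumes U: "U \<in> bounded_ops" and P: "projection P" and UU: "adj U o\<^sub>L U = P"
  shows "partial_isometry U"
  unfolding partial_isometry_def
proof (intro conjI allI impI U)
  fix x assume orth: "\<forall>y. blinfun_apply U y = 0 \<longrightarrow> cinner y x = 0"
  have nU: "(norm (blinfun_apply U z))\<^sup>2 = Re (cinner z (blinfun_apply P z))" for z
    by (simp add: Re_cinner_self[symmetric] UU[symmetric] cinner_adj_right[OF U])
  have hP: "hermitian P" using P by (rule projection_hermitian)
  have PP: "blinfun_apply P (blinfun_apply P z) = blinfun_apply P z" for z
    using P unfolding projection_def by (metis blinfun_apply_blinfun_compose)
  let ?y = "x - blinfun_apply P x"
  have Py: "blinfun_apply P ?y = 0" by (simp add: blinfun.diff_right PP)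
  then have "(norm (blinfun_apply U ?y))\<^sup>2 = 0" using nU[of ?y] by simp
  then have yx: "cinner ?y x = 0" using orth by simp
  have "(norm ?y)\<^sup>2 = Re (cinner ?y x) - Re (cinner (blinfun_apply P ?y) x)"
    by (simp add: Re_cinner_self[symmetric] cinner_diff_right hermitian_cinner[OF hP])
  then have "blinfun_apply P x = x" using yx Py by simp
  then show "norm (blinfun_apply U x) = norm x"
    using nU[of x] by (simp add: Re_cinner_self)
qed

text \<open>The hypothesis reads \<open>QP + PQ = P + Q - 1/2\<close>; multiplying it on the left by
  \<open>P\<close> or \<open>Q\<close> gives \<open>PQP = P/2\<close> and \<open>QPQ = Q/2\<close>.
  These three identities reduce both products of \<open>U\<close> with its adjoint.\<close>

lemma partial_isometry_of_square_half:
  assumes P: "projection P" and Q: "projection Q"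
    and half: "(P - Q) o\<^sub>L (P - Q) = (1/2) *\<^sub>R id_blinfun"
  defines "U \<equiv> 2 *\<^sub>R (Q o\<^sub>L P) - P"
  shows "partial_isometry U" "adj U o\<^sub>L U = P" "U o\<^sub>L adj U = id_blinfun - P"
    "Q = (1/2) *\<^sub>R (id_blinfun + U + adj U)"
proof -
  have PP: "P o\<^sub>L P = P" and QQ: "Q o\<^sub>L Q = Q" using P Q by (auto simp: projection_def)
  have PP': "P o\<^sub>L (P o\<^sub>L A) = P o\<^sub>L A" and QQ': "Q o\<^sub>L (Q o\<^sub>L A) = Q o\<^sub>L A" for A
    by (simp_all add: PP QQ flip: blinfun_compose_assoc)
  have hP: "hermitian P" and hQ: "hermitian Q" using P Q projection_hermitian by auto
  have E: "(Q o\<^sub>L P) + (P o\<^sub>L Q) = P + Q - (1/2) *\<^sub>R id_blinfun"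
    using half unfolding projection_difference_squares(1)[OF PP QQ] by (simp add: algebra_simps)
  have "P o\<^sub>L ((Q o\<^sub>L P) + (P o\<^sub>L Q)) = P o\<^sub>L (P + Q - (1/2) *\<^sub>R id_blinfun)" by (simp add: E)
  then have "(P o\<^sub>L (Q o\<^sub>L P)) = P - (1/2) *\<^sub>R P"
    by (simp add: blinfun_compose_simps PP PP' algebra_simps)
  then have PQP: "2 *\<^sub>R (P o\<^sub>L (Q o\<^sub>L P)) = P"
    by (simp add: scaleR_diff_right) (simp add: scaleR_2)
  have "Q o\<^sub>L ((Q o\<^sub>L P) + (P o\<^sub>L Q)) = Q o\<^sub>L (P + Q - (1/2) *\<^sub>R id_blinfun)" by (simp add: E)
  then have "(Q o\<^sub>L (P o\<^sub>L Q)) = Q - (1/2) *\<^sub>R Q"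
    by (simp add: blinfun_compose_simps QQ QQ' algebra_simps)
  then have QPQ: "2 *\<^sub>R (Q o\<^sub>L (P o\<^sub>L Q)) = Q"
    by (simp add: scaleR_diff_right) (simp add: scaleR_2)
  have bdU: "U \<in> bounded_ops"
    using hP hQ unfolding U_def by (intro bounded_ops_closed hermitian_bounded_ops)
  have adjU: "adj U = 2 *\<^sub>R (P o\<^sub>L Q) - P"
    unfolding U_def
    by (rule adj_eqI) (simp add: blinfun.diff_left blinfun.scaleR_left cinner_simps
        hermitian_cinner[OF hP] hermitian_cinner[OF hQ])
  show UU: "adj U o\<^sub>L U = P"
  proof -
    have "adj U o\<^sub>L U = 2 *\<^sub>R (2 *\<^sub>R (P o\<^sub>L (Q o\<^sub>L P))) - 2 *\<^sub>R (P o\<^sub>L (Q o\<^sub>L P)) - 2 *\<^sub>R (P o\<^sub>L (Q o\<^sub>L P)) + P"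
      unfolding adjU unfolding U_def
      by (simp add: blinfun_compose_simps blinfun_compose_assoc PP PP' QQ QQ' scaleR_diff_right)
    then show ?thesis unfolding PQP by (simp add: scaleR_2)
  qed
  have E2: "2 *\<^sub>R (Q o\<^sub>L P) + 2 *\<^sub>R (P o\<^sub>L Q) = 2 *\<^sub>R P + 2 *\<^sub>R Q - id_blinfun"
    using arg_cong[OF E, of "\<lambda>A. 2 *\<^sub>R A"] by (simp add: scaleR_add_right scaleR_diff_right)
  show "U o\<^sub>L adj U = id_blinfun - P"
  proof -
    have "U o\<^sub>L adj U = 2 *\<^sub>R (2 *\<^sub>R (Q o\<^sub>L (P o\<^sub>L Q))) - (2 *\<^sub>R (Q o\<^sub>L P) + 2 *\<^sub>R (P o\<^sub>L Q)) + P"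
      unfolding adjU unfolding U_def
      by (simp add: blinfun_compose_simps blinfun_compose_assoc PP PP' QQ QQ' scaleR_diff_right)
    then show ?thesis unfolding QPQ E2 by (simp add: scaleR_2)
  qed
  show "Q = (1/2) *\<^sub>R (id_blinfun + U + adj U)"
  proof -
    have "id_blinfun + U + adj U = id_blinfun + (2 *\<^sub>R (Q o\<^sub>L P) + 2 *\<^sub>R (P o\<^sub>L Q)) - 2 *\<^sub>R P"
      unfolding adjU unfolding U_def by (simp add: scaleR_2)
    also have "\<dots> = 2 *\<^sub>R Q" unfolding E2 by simp
    finally show ?thesis by simp
  qed
  show "partial_isometry U" by (rule partial_isometryI[OF bdU P UU])
qed

text \<open>\<open>U\<close> maps the range of \<open>P\<close> into its complement and kills that
  complement, so \<open>PQ = (P + adj U)/2\<close> and \<open>QP = (P + U)/2\<close>. In the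
  expanded square the terms in \<open>U\<close> cancel against those in \<open>Q\<close>.\<close>

lemma square_half_of_partial_isometry:
  assumes P: "projection P" and Q: "projection Q" and U: "U \<in> bounded_ops"
    and UU: "adj U o\<^sub>L U = P" and UU': "U o\<^sub>L adj U = id_blinfun - P"
    and Q_eq: "Q = (1/2) *\<^sub>R (id_blinfun + U + adj U)"
  shows "(P - Q) o\<^sub>L (P - Q) = (1/2) *\<^sub>R id_blinfun"
proof -
  have PP: "P o\<^sub>L P = P" and QQ: "Q o\<^sub>L Q = Q" using P Q by (auto simp: projection_def)
  have PPx: "blinfun_apply P (blinfun_apply P x) = blinfun_apply P x" for x
    by (metis PP blinfun_apply_blinfun_compose)
  have hP: "hermitian P" using P by (rule projection_hermitian)
  have nU: "(norm (blinfun_apply U z))\<^sup>2 = Re (cinner z (blinfun_apply P z))" for z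
    by (simp add: Re_cinner_self[symmetric] UU[symmetric] cinner_adj_right[OF U])
  have nU': "(norm (blinfun_apply (adj U) z))\<^sup>2 = Re (cinner z (blinfun_apply (id_blinfun - P) z))" for z
    by (simp add: Re_cinner_self[symmetric] UU'[symmetric] cinner_adj[OF U])
  \<comment> \<open>The norm of \<open>U z\<close> is read off from \<open>P\<close>, so
    \<open>U\<close> kills the kernel of \<open>P\<close>; likewise \<open>adj U\<close> kills its
    range.\<close>
  have UP: "blinfun_apply U (blinfun_apply P x) = blinfun_apply U x" for x
  proof -
    have "(norm (blinfun_apply U (x - blinfun_apply P x)))\<^sup>2 = 0"
      unfolding nU by (simp add: blinfun.diff_right PPx)
    then show ?thesis by (simp add: blinfun.diff_right)
  qed
  have U'P: "blinfun_apply (adj U) (blinfun_apply P x) = 0" for x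
  proof -
    have "(norm (blinfun_apply (adj U) (blinfun_apply P x)))\<^sup>2 = 0"
      unfolding nU' by (simp add: blinfun.diff_left PPx)
    then show ?thesis by simp
  qed
  have PU: "blinfun_apply P (blinfun_apply U x) = 0" for x
    by (rule cinner_eqI)
       (simp add: hermitian_cinner[OF hP] U'P flip: cinner_adj_right[OF U])
  have PU': "blinfun_apply P (blinfun_apply (adj U) x) = blinfun_apply (adj U) x" for x
    by (rule cinner_eqI) (simp add: hermitian_cinner[OF hP] cinner_adj[OF U] UP)
  have PQ: "P o\<^sub>L Q = (1/2) *\<^sub>R (P + adj U)"
    by (rule blinfun_eqI)
       (simp add: Q_eq blinfun.add_left blinfun.scaleR_left blinfun.add_right blinfun.scaleR_right PU PU')
  have QP: "Q o\<^sub>L P = (1/2) *\<^sub>R (P + U)"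
    by (rule blinfun_eqI)
       (simp add: Q_eq blinfun.add_left blinfun.scaleR_left UP U'P)
  have "(P - Q) o\<^sub>L (P - Q) = P + Q - (1/2) *\<^sub>R (P + adj U) - (1/2) *\<^sub>R (P + U)"
    unfolding projection_difference_squares(1)[OF PP QQ] PQ QP ..
  also have "\<dots> = P + (1/2) *\<^sub>R id_blinfun - ((1/2) *\<^sub>R P + (1/2) *\<^sub>R P)"
    unfolding Q_eq by (simp add: scaleR_add_right)
  also have "\<dots> = (1/2) *\<^sub>R id_blinfun"
    unfolding scaleR_add_left[symmetric] by simp
  finally show ?thesis .
qed

theorem lemma3p1:
  fixes M :: "('h::chilbert_space) op set"
    and \<tau> :: "'h op \<Rightarrow> complex"
    and p :: real
    and P Q :: "'h op"
  assumes "0 < p" and "p \<noteq> 2"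
    and "finite_factor M"
    and "faithful_normal_tracial_state M \<tau>"
    and "P \<in> half_projections M \<tau>"
    and "Q \<in> half_projections M \<tau>"
  shows "(trace_pnorm \<tau> p (P - Q) = trace_pnorm \<tau> p ((id_blinfun - P) - Q) \<and>
          trace_pnorm \<tau> p ((id_blinfun - P) - Q) = 1 / sqrt 2)
     \<longleftrightarrow> (\<exists>U\<in>M. partial_isometry U \<and> adj U o\<^sub>L U = P \<and> U o\<^sub>L adj U = id_blinfun - P \<and>
            Q = (1/2) *\<^sub>R (id_blinfun + U + adj U))"
proof -
  interpret tracial_algebra M \<tau>
    using assms(3,4)
    by unfold_locales (auto simp: finite_factor_def factor_def faithful_normal_tracial_state_def)
  have faithful: "faithful_on M \<tau>" using assms(4) by (simp add: faithful_normal_tracial_state_def)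
  have P: "P \<in> M" "projection P" and Q: "Q \<in> M" "projection Q"
    using assms(5,6) by (auto simp: half_projections_def)
  have PP: "P o\<^sub>L P = P" and QQ: "Q o\<^sub>L Q = Q" using P Q by (auto simp: projection_def)
  let ?X = "P - Q" and ?Y = "id_blinfun - P - Q"
  have X: "?X \<in> M" "hermitian ?X" and Y: "?Y \<in> M" "hermitian ?Y"
    using P(1) Q(1) mem_id projection_hermitian[OF P(2)] projection_hermitian[OF Q(2)]
    by (simp_all add: mem_diff hermitian_diff hermitian_id)
  have sum: "(?X o\<^sub>L ?X) + (?Y o\<^sub>L ?Y) = id_blinfun"
    by (rule projection_difference_squares(2)[OF PP QQ])
  have sum': "(?Y o\<^sub>L ?Y) + (?X o\<^sub>L ?X) = id_blinfun"
    using sum by (simp add: add.commute)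
  show ?thesis
  proof
    assume "trace_pnorm \<tau> p ?X = trace_pnorm \<tau> p ?Y \<and> trace_pnorm \<tau> p ?Y = 1 / sqrt 2"
    then have "?X o\<^sub>L ?X = (1/2) *\<^sub>R id_blinfun"
      by (intro square_half_of_trace_pnorm[OF faithful assms(1,2) X Y sum]) auto
    note * = partial_isometry_of_square_half[OF P(2) Q(2) this]
    have "2 *\<^sub>R (Q o\<^sub>L P) - P \<in> M"
      using P Q by (intro mem_diff mem_scaleR mem_comp)
    then show "\<exists>U\<in>M. partial_isometry U \<and> adj U o\<^sub>L U = P \<and> U o\<^sub>L adj U = id_blinfun - P \<and>
            Q = (1/2) *\<^sub>R (id_blinfun + U + adj U)"
      using * by (intro bexI conjI)
  next
    assume "\<exists>U\<in>M. partial_isometry U \<and> adj U o\<^sub>L U = P \<and> U o\<^sub>L adj U = id_blinfun - P \<and>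
            Q = (1/2) *\<^sub>R (id_blinfun + U + adj U)"
    then have XX: "?X o\<^sub>L ?X = (1/2) *\<^sub>R id_blinfun"
      using square_half_of_partial_isometry[OF P(2) Q(2)] by (auto simp: partial_isometry_def)
    \<comment> \<open>The complementary square is \<open>I - I/2\<close>, so the same lemma handles
      both norms.\<close>
    then have "?Y o\<^sub>L ?Y = id_blinfun - (1/2) *\<^sub>R id_blinfun"
      using sum by (metis add_diff_cancel_left')
    also have "\<dots> = (1/2) *\<^sub>R id_blinfun"
      using scaleR_diff_left[of 1 "1/2" "id_blinfun :: 'h op"] by simp
    finally have YY: "?Y o\<^sub>L ?Y = (1/2) *\<^sub>R id_blinfun" .
    show "trace_pnorm \<tau> p ?X = trace_pnorm \<tau> p ?Y \<and> trace_pnorm \<tau> p ?Y = 1 / sqrt 2"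
      using trace_pnorm_of_square_half[OF X norm_le_1_of_squares[OF X(2) Y(2) sum] XX assms(1)]
        trace_pnorm_of_square_half[OF Y norm_le_1_of_squares[OF Y(2) X(2) sum'] YY assms(1)]
      by simp
  qed
qed

end
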